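(* Let $\omega$ denote the matrix-multiplication exponent. If for some fixed $\varepsilon>0$ and any $k\in[n^{1/2},n]$, the $k$-bounded version of All-Pairs Min-Cut can be solved on $n$-vertex DAGs with unit vertex capacities in time $O\big((n^{\omega-1}k^2)^{1-\varepsilon}\big)$, then $4$-Clique can be solved in time $O(n^{\omega+1-\delta})$ for some $\delta=\delta(\varepsilon)>0$. Moreover, if for some fixed $\varepsilon>0$ and any $k\in[n^{1/2},n]$ that version of All-Pairs Min-Cut can be solved by a combinatorial algorithm in time $O\big((n^{2}k^2)^{1-\varepsilon}\big)$, then $4$-Clique can be solved by a combinatorial algorithm in time $O(n^{4-\delta})$ for some $\delta=\delta(\varepsilon)>0$.
   Context: The $k$-bounded All-Pairs Min-Cut problem with unit vertex capacities: given a directed graph $G=(V,E)$ with $n$ vertices and a parameter $k$, for every ordered pair of vertices $s,t$ determine whether the minimum $s$-$t$ vertex cut value (i.e., the maximum number of internally vertex-disjoint $s$-$t$ paths) is less than $k$, and if so report its value. The $4$-Clique problem: given a $4$-partite undirected graph with vertex parts $A,B,C,D$, each of size $n$, decide whether there exist $a\in A,b\in B,c\in C,d\in D$ that are pairwise adjacent. "Combinatorial" informally means not using fast matrix multiplication. *)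

theory Defs
  imports Complex_Main
begin

section \<open>Vertex-disjoint paths and the two graph problems\<close>

definition vertex_path :: "('a \<times> 'a) set \<Rightarrow> 'a \<Rightarrow> 'a \<Rightarrow> 'a list \<Rightarrow> bool" where
  "vertex_path E s t p \<longleftrightarrow>
     p \<noteq> [] \<and> hd p = s \<and> last p = t \<and> distinct p \<and> successively (\<lambda>u v. (u, v) \<in> E) p"

definition internally_disjoint_paths :: "('a \<times> 'a) set \<Rightarrow> 'a \<Rightarrow> 'a \<Rightarrow> 'a list set \<Rightarrow> bool" where
  "internally_disjoint_paths E s t P \<longleftrightarrow>
     (\<forall>p\<in>P. vertex_path E s t p) \<and>
     (\<forall>p\<in>P. \<forall>q\<in>P. p \<noteq> q \<longrightarrow> set p \<inter> set q \<subseteq> {s, t})"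

text \<open>The minimum cut value for unit vertex capacities is the maximum number of internally
  vertex-disjoint paths. An edge from \<open>s\<close> to \<open>t\<close> is a path without internal vertices and
  contributes one to that number.\<close>

definition min_vertex_cut :: "('a \<times> 'a) set \<Rightarrow> 'a \<Rightarrow> 'a \<Rightarrow> nat" where
  "min_vertex_cut E s t = Max {card P | P. internally_disjoint_paths E s t P}"

definition dag :: "nat \<Rightarrow> (nat \<times> nat) set \<Rightarrow> bool" where
  "dag n E \<longleftrightarrow> E \<subseteq> {..<n} \<times> {..<n} \<and> acyclic E"

text \<open>The four parts of size \<open>n\<close> are \<open>{0..<n}\<close>, \<open>{n..<2*n}\<close>, \<open>{2*n..<3*n}\<close>, \<open>{3*n..<4*n}\<close>;
  the part of a vertex \<open>u\<close> is \<open>u div n\<close>. Undirected graphs are symmetric relations.\<close>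

definition four_partite :: "nat \<Rightarrow> (nat \<times> nat) set \<Rightarrow> bool" where
  "four_partite n E \<longleftrightarrow>
     E \<subseteq> {..<4*n} \<times> {..<4*n} \<and> sym E \<and> (\<forall>(u, v)\<in>E. u div n \<noteq> v div n)"

definition has_four_clique :: "nat \<Rightarrow> (nat \<times> nat) set \<Rightarrow> bool" where
  "has_four_clique n E \<longleftrightarrow>
     (\<exists>a\<in>{0..<n}. \<exists>b\<in>{n..<2*n}. \<exists>c\<in>{2*n..<3*n}. \<exists>d\<in>{3*n..<4*n}.
        (a, b) \<in> E \<and> (a, c) \<in> E \<and> (a, d) \<in> E \<and> (b, c) \<in> E \<and> (b, d) \<in> E \<and> (c, d) \<in> E)"


section \<open>The matrix multiplication exponent\<close>

text \<open>Straight-line programs over a ring. A computation is the list of the values obtained so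
  far; an operation refers to its operands by their positions in that list.\<close>

datatype 'a arith_op = AConst 'a | AAdd nat nat | ASub nat nat | AMul nat nat

definition value_at :: "'a::ring_1 list \<Rightarrow> nat \<Rightarrow> 'a" where
  "value_at vs i = (if i < length vs then vs ! i else 0)"

primrec arith_val :: "'a::ring_1 list \<Rightarrow> 'a arith_op \<Rightarrow> 'a" where
  "arith_val vs (AConst c) = c"
| "arith_val vs (AAdd i j) = value_at vs i + value_at vs j"
| "arith_val vs (ASub i j) = value_at vs i - value_at vs j"
| "arith_val vs (AMul i j) = value_at vs i * value_at vs j"

definition run_arith :: "'a::ring_1 arith_op list \<Rightarrow> 'a list \<Rightarrow> 'a list" where
  "run_arith p vs = foldl (\<lambda>ws i. ws @ [arith_val ws i]) vs p"

definition matrix_entries :: "nat \<Rightarrow> (nat \<Rightarrow> nat \<Rightarrow> 'a) \<Rightarrow> 'a list" where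
  "matrix_entries n A = map (\<lambda>m. A (m div n) (m mod n)) [0..<n*n]"

definition multiplies_matrices :: "nat \<Rightarrow> real arith_op list \<Rightarrow> bool" where
  "multiplies_matrices n p \<longleftrightarrow>
     (\<exists>pos. \<forall>A B. \<forall>i<n. \<forall>j<n.
        value_at (run_arith p (matrix_entries n A @ matrix_entries n B)) (pos i j)
          = (\<Sum>l<n. A i l * B l j))"

definition mm_exponent :: real where
  "mm_exponent = Inf {\<tau>. \<exists>C. \<forall>n\<ge>1. \<exists>p.
     multiplies_matrices n p \<and> real (length p) \<le> C * real n powr \<tau>}"


section \<open>A word RAM\<close>

text \<open>A structured random access machine with finitely many scalar registers and arrays (those
  named in the program), all indexed by natural numbers. Every command costs one step; expressions
  have constant size for a given program. Execution is relative to a word bound \<open>W\<close>: it is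
  impossible if a value or address that is \<open>\<ge> W\<close> arises. Subtraction is truncated.\<close>

datatype binop = Add | Sub | Mul | Div | Mod | BitAnd | BitOr | BitXor | ShiftL | ShiftR | Less | Eq

primrec binop_val :: "binop \<Rightarrow> nat \<Rightarrow> nat \<Rightarrow> nat" where
  "binop_val Add x y = x + y"
| "binop_val Sub x y = x - y"
| "binop_val Mul x y = x * y"
| "binop_val Div x y = x div y"
| "binop_val Mod x y = x mod y"
| "binop_val BitAnd x y = Bit_Operations.and x y"
| "binop_val BitOr x y = Bit_Operations.or x y"
| "binop_val BitXor x y = Bit_Operations.xor x y"
| "binop_val ShiftL x y = push_bit y x"
| "binop_val ShiftR x y = drop_bit y x"
| "binop_val Less x y = (if x < y then 1 else 0)"
| "binop_val Eq x y = (if x = y then 1 else 0)"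

datatype expr = Const nat | Var nat | Read nat expr | Op binop expr expr

text \<open>Contents of the registers, and contents of the arrays (array name first).\<close>

type_synonym state = "(nat \<Rightarrow> nat) \<times> (nat \<Rightarrow> nat \<Rightarrow> nat)"

primrec eval :: "expr \<Rightarrow> state \<Rightarrow> nat" where
  "eval (Const c) s = c"
| "eval (Var x) s = fst s x"
| "eval (Read a e) s = snd s a (eval e s)"
| "eval (Op f e e') s = binop_val f (eval e s) (eval e' s)"

primrec fits :: "nat \<Rightarrow> expr \<Rightarrow> state \<Rightarrow> bool" where
  "fits W (Const c) s \<longleftrightarrow> c < W"
| "fits W (Var x) s \<longleftrightarrow> fst s x < W"
| "fits W (Read a e) s \<longleftrightarrow> fits W e s \<and> eval (Read a e) s < W"
| "fits W (Op f e e') s \<longleftrightarrow> fits W e s \<and> fits W e' s \<and> eval (Op f e e') s < W"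

datatype com =
    Skip
  | Assign nat expr
  | Write nat expr expr
  | Seq com com
  | Cond expr com com
  | While expr com
  | Call com nat nat

text \<open>Array \<open>0\<close> holds the input and array \<open>1\<close> the output; everything else is initially zero.
  \<open>Call c a b\<close> runs the subprogram \<open>c\<close> on the contents of array \<open>a\<close> in a memory of its own and
  makes its output the new contents of array \<open>b\<close>. Its cost is one step plus the cost of \<open>c\<close>:
  passing arrays by reference, recording the changes of the callee to its input in an overlay,
  and initialising arrays lazily implements this on a flat memory with constant overhead.\<close>

definition start :: "(nat \<Rightarrow> nat) \<Rightarrow> state" where
  "start inp = (\<lambda>_. 0, (\<lambda>_ _. 0)(0 := inp))"

inductive exec :: "nat \<Rightarrow> com \<Rightarrow> state \<Rightarrow> nat \<Rightarrow> state \<Rightarrow> bool" for W :: nat where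
  Skip: "exec W Skip s 1 s"
| Assign: "fits W e s \<Longrightarrow> exec W (Assign x e) s 1 ((fst s)(x := eval e s), snd s)"
| Write: "fits W e s \<Longrightarrow> fits W e' s \<Longrightarrow>
    exec W (Write a e e') s 1 (fst s, (snd s)(a := (snd s a)(eval e s := eval e' s)))"
| Seq: "exec W c s m s' \<Longrightarrow> exec W c' s' m' s'' \<Longrightarrow> exec W (Seq c c') s (m + m') s''"
| CondTrue: "fits W e s \<Longrightarrow> eval e s \<noteq> 0 \<Longrightarrow> exec W c s m s' \<Longrightarrow>
    exec W (Cond e c c') s (Suc m) s'"
| CondFalse: "fits W e s \<Longrightarrow> eval e s = 0 \<Longrightarrow> exec W c' s m s' \<Longrightarrow>
    exec W (Cond e c c') s (Suc m) s'"
| WhileFalse: "fits W e s \<Longrightarrow> eval e s = 0 \<Longrightarrow> exec W (While e c) s 1 s"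
| WhileTrue: "fits W e s \<Longrightarrow> eval e s \<noteq> 0 \<Longrightarrow> exec W c s m s' \<Longrightarrow>
    exec W (While e c) s' m' s'' \<Longrightarrow> exec W (While e c) s (Suc (m + m')) s''"
| Call: "exec W c (start (snd s a)) m s' \<Longrightarrow>
    exec W (Call c a b) s (Suc m) (fst s, (snd s)(b := snd s' 1))"

definition computes_within ::
  "nat \<Rightarrow> com \<Rightarrow> (nat \<Rightarrow> nat) \<Rightarrow> real \<Rightarrow> ((nat \<Rightarrow> nat) \<Rightarrow> bool) \<Rightarrow> bool" where
  "computes_within W P inp T Q \<longleftrightarrow>
     (\<exists>m s. exec W P (start inp) m s \<and> real m \<le> T \<and> Q (snd s 1))"

text \<open>\<open>solves_in_O P f inst inp spec\<close>: on words of \<open>O(log n)\<close> bits, that is, with word bound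
  \<open>(n + 2) ^ c\<close>, the program solves every instance of size \<open>n \<ge> 1\<close> in time \<open>O(f n)\<close>.\<close>

definition solves_in_O ::
  "com \<Rightarrow> (nat \<Rightarrow> real) \<Rightarrow> (nat \<Rightarrow> 'i \<Rightarrow> bool) \<Rightarrow> (nat \<Rightarrow> 'i \<Rightarrow> nat \<Rightarrow> nat)
    \<Rightarrow> (nat \<Rightarrow> 'i \<Rightarrow> (nat \<Rightarrow> nat) \<Rightarrow> bool) \<Rightarrow> bool" where
  "solves_in_O P f inst inp spec \<longleftrightarrow>
     (\<exists>c C. \<forall>n\<ge>1. \<forall>x. inst n x \<longrightarrow>
        computes_within ((n + 2) ^ c) P (inp n x) (C * f n) (spec n x))"


section \<open>The problems on the word RAM\<close>

definition apmc_input :: "(nat \<Rightarrow> nat) \<Rightarrow> nat \<Rightarrow> (nat \<times> nat) set \<Rightarrow> nat \<Rightarrow> nat" where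
  "apmc_input k n E i =
     (if i = 0 then n
      else if i = 1 then k n
      else if i - 2 < n * n \<and> ((i - 2) div n, (i - 2) mod n) \<in> E then 1
      else 0)"

text \<open>The answer \<open>k n\<close> for a pair says that its cut value is not less than \<open>k n\<close>.\<close>

definition apmc_spec :: "(nat \<Rightarrow> nat) \<Rightarrow> nat \<Rightarrow> (nat \<times> nat) set \<Rightarrow> (nat \<Rightarrow> nat) \<Rightarrow> bool" where
  "apmc_spec k n E out \<longleftrightarrow>
     (\<forall>s<n. \<forall>t<n. s \<noteq> t \<longrightarrow>
        out (s * n + t) = (if min_vertex_cut E s t < k n then min_vertex_cut E s t else k n))"

definition solves_bounded_apmc :: "(nat \<Rightarrow> nat) \<Rightarrow> com \<Rightarrow> (nat \<Rightarrow> real) \<Rightarrow> bool" where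
  "solves_bounded_apmc k P f \<longleftrightarrow> solves_in_O P f dag (apmc_input k) (apmc_spec k)"

definition clique_input :: "nat \<Rightarrow> (nat \<times> nat) set \<Rightarrow> nat \<Rightarrow> nat" where
  "clique_input n E i =
     (if i = 0 then n
      else if i - 1 < (4*n) * (4*n) \<and> ((i - 1) div (4*n), (i - 1) mod (4*n)) \<in> E then 1
      else 0)"

definition clique_spec :: "nat \<Rightarrow> (nat \<times> nat) set \<Rightarrow> (nat \<Rightarrow> nat) \<Rightarrow> bool" where
  "clique_spec n E out \<longleftrightarrow> out 0 = (if has_four_clique n E then 1 else 0)"

definition solves_four_clique :: "com \<Rightarrow> (nat \<Rightarrow> real) \<Rightarrow> bool" where
  "solves_four_clique P f \<longleftrightarrow> solves_in_O P f four_partite clique_input clique_spec"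

text \<open>A parameter is a function \<open>k = k(n)\<close> with values between \<open>sqrt n\<close> and \<open>n\<close>. As usual for
  parameters of this kind it has to be constructible: computable from \<open>n\<close> in time \<open>O(n^2)\<close>,
  the size of an adjacency matrix.\<close>

definition admissible_parameter :: "(nat \<Rightarrow> nat) \<Rightarrow> bool" where
  "admissible_parameter k \<longleftrightarrow>
     (\<forall>n. sqrt (real n) \<le> real (k n) \<and> k n \<le> n) \<and>
     (\<exists>P. solves_in_O P (\<lambda>n. real n ^ 2) (\<lambda>_ (_::unit). True)
            (\<lambda>n _ i. if i = 0 then n else 0) (\<lambda>n _ out. out 0 = k n))"


section \<open>Combinatorial algorithms\<close>

text \<open>``Combinatorial'' has no formal definition. It is treated as an arbitrary class of programs
  about which only one thing is assumed: a combinatorial program remains combinatorial if it is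
  used as the subroutine of a reduction that does nothing but move data. In such a reduction every
  array has a role:
  \<^item> Control flow, addresses, and \<open>Control\<close> arrays depend only on the size \<open>n\<close>, stored in cell \<open>0\<close>
    of the input.
  \<^item> An entry of a \<open>Query\<close> array depends only on \<open>n\<close>, or is a copy or the complement of one input
    entry.
  \<^item> The subroutine is run on \<open>Query\<close> arrays; its answers go to \<open>Result\<close> arrays. Later queries
    cannot depend on them.
  \<^item> The reduction accepts, that is, sets cell \<open>0\<close> of the output to \<open>1\<close>, if for one of the tested
    tuples of entries of the input and the results some comparisons have the right outcome.

  So a reduction performs no arithmetic on data at all, and fast matrix multiplication cannot be
  hidden in it; in particular the assumption does not force the class to contain all programs.\<close>

datatype role = Input | Output | Control | Query | Result

primrec control_expr :: "(nat \<Rightarrow> role) \<Rightarrow> expr \<Rightarrow> bool" where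
  "control_expr r (Const c) \<longleftrightarrow> True"
| "control_expr r (Var x) \<longleftrightarrow> True"
| "control_expr r (Read a e) \<longleftrightarrow>
     r a = Input \<and> e = Const 0 \<or> r a = Control \<and> control_expr r e"
| "control_expr r (Op f e e') \<longleftrightarrow> control_expr r e \<and> control_expr r e'"

inductive query_expr :: "(nat \<Rightarrow> role) \<Rightarrow> expr \<Rightarrow> bool" for r where
  "control_expr r e \<Longrightarrow> query_expr r e"
| "r a = Input \<Longrightarrow> control_expr r e \<Longrightarrow> query_expr r (Read a e)"
| "r a = Input \<Longrightarrow> control_expr r e \<Longrightarrow> query_expr r (Op Sub (Const 1) (Read a e))"

inductive test_operand :: "(nat \<Rightarrow> role) \<Rightarrow> expr \<Rightarrow> bool" for r where
  "control_expr r e \<Longrightarrow> test_operand r e"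
| "r a = Input \<or> r a = Result \<Longrightarrow> control_expr r e \<Longrightarrow> test_operand r (Read a e)"

inductive acceptance_test :: "(nat \<Rightarrow> role) \<Rightarrow> com \<Rightarrow> bool" for r where
  "acceptance_test r Skip"
| "r a = Output \<Longrightarrow> acceptance_test r (Write a (Const 0) (Const 1))"
| "f \<in> {Less, Eq} \<Longrightarrow> test_operand r e \<Longrightarrow> test_operand r e' \<Longrightarrow>
    acceptance_test r c \<Longrightarrow> acceptance_test r c' \<Longrightarrow> acceptance_test r (Cond (Op f e e') c c')"

text \<open>\<open>data_reduction r P Q\<close>: \<open>Q\<close> is a reduction of this kind with subroutine \<open>P\<close>.\<close>

inductive data_reduction :: "(nat \<Rightarrow> role) \<Rightarrow> com \<Rightarrow> com \<Rightarrow> bool" for r P where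
  "data_reduction r P Skip"
| "control_expr r e \<Longrightarrow> data_reduction r P (Assign x e)"
| "r a = Control \<Longrightarrow> control_expr r e \<Longrightarrow> control_expr r e' \<Longrightarrow>
    data_reduction r P (Write a e e')"
| "r a = Query \<Longrightarrow> control_expr r e \<Longrightarrow> query_expr r e' \<Longrightarrow>
    data_reduction r P (Write a e e')"
| "data_reduction r P c \<Longrightarrow> data_reduction r P c' \<Longrightarrow> data_reduction r P (Seq c c')"
| "control_expr r e \<Longrightarrow> data_reduction r P c \<Longrightarrow> data_reduction r P c' \<Longrightarrow>
    data_reduction r P (Cond e c c')"
| "control_expr r e \<Longrightarrow> data_reduction r P c \<Longrightarrow> data_reduction r P (While e c)"
| "r a = Control \<Longrightarrow> r b = Control \<Longrightarrow> data_reduction r P (Call c a b)"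
| "r a = Query \<Longrightarrow> r b = Result \<Longrightarrow> data_reduction r P (Call P a b)"
| "acceptance_test r c \<Longrightarrow> data_reduction r P c"

definition combinatorial_class :: "(com \<Rightarrow> bool) \<Rightarrow> bool" where
  "combinatorial_class comb \<longleftrightarrow>
     (\<forall>r P Q. comb P \<and> r 0 = Input \<and> r 1 = Output \<and> (\<forall>a\<ge>2. r a \<noteq> Input \<and> r a \<noteq> Output) \<and>
        data_reduction r P Q \<longrightarrow> comb Q)"

end

theory Submission
  imports Defs
begin

text \<open>Let \<open>A, B, C, D\<close> be the parts of the clique instance. Direct its edges from \<open>A\<close> to \<open>B\<close>, from \<open>B\<close>
  to \<open>C\<close> and from \<open>C\<close> to \<open>D\<close>, and add the arcs \<open>bd\<close> and \<open>ac\<close> for the pairs that are \<^emph>\<open>not\<close> adjacent.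
  For \<open>a \<in> A\<close> and \<open>d \<in> D\<close> let \<open>X\<close> consist of the neighbours of \<open>a\<close> in \<open>B\<close> that are not adjacent to
  \<open>d\<close> and the neighbours of \<open>d\<close> in \<open>C\<close> that are not adjacent to \<open>a\<close>. Every vertex of \<open>X\<close> is on a path
  of length two from \<open>a\<close> to \<open>d\<close>, and if \<open>a\<close> and \<open>d\<close> are adjacent but in no 4-clique, \<open>X\<close> meets all
  paths from \<open>a\<close> to \<open>d\<close>. So the cut value is \<open>|X|\<close> in this case, and larger if there is a 4-clique.
  A reduction cannot count, but it can read off \<open>|X|\<close> as the cut value of the graph without the arcs
  from \<open>B\<close> to \<open>C\<close>, and compare.

  For \<open>|X| < k\<close>, split \<open>B\<close> and \<open>C\<close> into groups of size about \<open>k / 2\<close> and treat the \<open>O((n / k)\<^sup>2)\<close> pairs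
  of groups separately. With \<open>k\<^sup>2 \<ge> n\<close> the calls take time
  \<open>(n / k)\<^sup>2 (n powr (w - 1) k\<^sup>2) powr (1 - \<epsilon>) \<le> n powr (w + 1 - \<epsilon> w)\<close>, where \<open>w\<close> is the exponent of matrix
  multiplication, or \<open>3\<close> for combinatorial algorithms. Constructing a query takes time \<open>O(n\<^sup>2)\<close>, which
  is no more than the subroutine needs to write down its answers.\<close>

section \<open>Running programs within a time bound\<close>

lemma fits_mono: "fits W e s \<Longrightarrow> W \<le> W' \<Longrightarrow> fits W' e s"
  by (induction e) auto

lemma exec_mono: "exec W c s m s' \<Longrightarrow> W \<le> W' \<Longrightarrow> exec W' c s m s'"
proof (induction rule: exec.induct)
  case (Skip s)
  show ?case by (rule exec.Skip)
next
  case (Assign e s x)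
  then show ?case by (rule exec.Assign[OF fits_mono])
next
  case (Write e s e' a)
  then show ?case by (meson exec.Write fits_mono)
next
  case (Seq c s m s' c' m' s'')
  then show ?case by (intro exec.Seq)
next
  case (CondTrue e s c m s' c')
  then show ?case by (meson exec.CondTrue fits_mono)
next
  case (CondFalse e s c' m s' c)
  then show ?case by (meson exec.CondFalse fits_mono)
next
  case (WhileFalse e s c)
  then show ?case by (meson exec.WhileFalse fits_mono)
next
  case (WhileTrue e s c m s' m' s'')
  from exec.WhileTrue[OF fits_mono[OF WhileTrue.hyps(1) WhileTrue.prems] WhileTrue.hyps(2)
      WhileTrue.IH(1)[OF WhileTrue.prems] WhileTrue.IH(2)[OF WhileTrue.prems]]
  show ?case .
next
  case (Call c s a m s' b)
  then show ?case by (intro exec.Call)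
qed

text \<open>The subprograms come with word bounds of their own, powers of \<open>9 * n + 2\<close>;
  the reduction runs all of them under one common larger bound.\<close>

lemma computes_within_mono:
  "computes_within W P inp T Q \<Longrightarrow> W \<le> W' \<Longrightarrow> computes_within W' P inp T Q"
  unfolding computes_within_def using exec_mono by blast

section \<open>Running time bounds the number of nonzero cells\<close>

definition support :: "(nat \<Rightarrow> nat) \<Rightarrow> nat set" where
  "support f = {i. f i \<noteq> 0}"

text \<open>A single step can replace a whole array, but then by the output of a call, which started
  out as zero.\<close>

lemma exec_support:
  "exec W c s m s' \<Longrightarrow> finite (support (snd s a)) \<Longrightarrow>
     finite (support (snd s' a)) \<and> card (support (snd s' a)) \<le> card (support (snd s a)) + m"
proof (induction arbitrary: a rule: exec.induct)
  case (Write e s e' b)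
  let ?f = "snd s b" and ?i = "eval e s" and ?v = "eval e' s"
  have sub: "support (?f(?i := ?v)) \<subseteq> insert ?i (support ?f)"
    by (auto simp: support_def)
  show ?case
  proof (cases "a = b")
    case True
    with Write.prems have fin: "finite (insert ?i (support ?f))" by simp
    have "card (support (?f(?i := ?v))) \<le> card (insert ?i (support ?f))"
      using card_mono[OF fin sub] .
    also have "\<dots> \<le> card (support ?f) + 1"
      using fin by (simp add: card_insert_if)
    finally show ?thesis using True finite_subset[OF sub fin] by (simp del: fun_upd_apply add: fun_upd_same)
  qed (use Write.prems in simp)
next
  case (Call c s b m s' b')
  have "support (snd (start (snd s b)) 1) = {}"
    by (simp add: support_def start_def)
  then have "finite (support (snd s' 1)) \<and> card (support (snd s' 1)) \<le> m"
    using Call.IH[of 1] by simp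
  then show ?case
    using Call.prems by simp
next
  case (Seq c s m s' c' m' s'')
  from Seq.IH(1)[OF Seq.prems] Seq.IH(2)[of a] show ?case by linarith
next
  case (WhileTrue e s c m s' m' s'')
  from WhileTrue.IH(1)[OF WhileTrue.prems] WhileTrue.IH(2)[of a] show ?case by linarith
next
  case (CondTrue e s c m s' c')
  from CondTrue.IH[OF CondTrue.prems] show ?case by linarith
next
  case (CondFalse e s c' m s' c)
  from CondFalse.IH[OF CondFalse.prems] show ?case by linarith
qed simp_all

section \<open>Total correctness with time bounds\<close>

definition runs :: "nat \<Rightarrow> nat \<Rightarrow> com \<Rightarrow> (state \<Rightarrow> bool) \<Rightarrow> state \<Rightarrow> bool" where
  "runs W T c Q s \<longleftrightarrow> (\<exists>m s'. exec W c s m s' \<and> m \<le> T \<and> Q s')"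

lemma runs_mono:
  "runs W T c Q s \<Longrightarrow> T \<le> T' \<Longrightarrow> (\<And>s'. Q s' \<Longrightarrow> Q' s') \<Longrightarrow> runs W T' c Q' s"
  unfolding runs_def by (meson order_trans)

lemma runs_Seq:
  assumes "runs W T c R s" and "\<And>s'. R s' \<Longrightarrow> runs W T' c' Q s'"
  shows "runs W (T + T') (Seq c c') Q s"
  using assms unfolding runs_def by (meson add_mono exec.Seq)

text \<open>\<open>computes_within\<close> has a real time bound and \<open>runs\<close> a natural
  one; the number of steps is an integer, so rounding down is harmless. The \<open>Suc\<close> pays
  for the call itself.\<close>

lemma runs_Call:
  assumes "computes_within W c (snd s a) T R"
    and "\<And>out. R out \<Longrightarrow> Q (fst s, (snd s)(b := out))"
  shows "runs W (Suc (nat \<lfloor>T\<rfloor>)) (Call c a b) Q s"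
proof -
  obtain m s' where m: "exec W c (start (snd s a)) m s'" "real m \<le> T" "R (snd s' 1)"
    using assms(1) unfolding computes_within_def by blast
  from m(2) have "m \<le> nat \<lfloor>T\<rfloor>" by linarith
  with m assms(2) show ?thesis
    unfolding runs_def by (meson Suc_le_mono exec.Call)
qed

text \<open>The invariant is indexed by the number of completed iterations, so it also proves
  termination after exactly \<open>B\<close> of them. Each iteration pays one step for its guard,
  and the failing guard at the end costs the last step.\<close>

lemma runs_While:
  assumes step: "\<And>j s. j < B \<Longrightarrow> I j s \<Longrightarrow> fits W e s \<and> eval e s \<noteq> 0 \<and> runs W T c (I (Suc j)) s"
    and exit: "\<And>s. I B s \<Longrightarrow> fits W e s \<and> eval e s = 0"
    and "I 0 s"
  shows "runs W (B * Suc T + 1) (While e c) (I B) s"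
proof -
  \<comment> \<open>Generalised to a start after \<open>j\<close> iterations, so that the induction
    can run on the number of remaining ones.\<close>
  have "runs W ((B - j) * Suc T + 1) (While e c) (I B) s" if "j \<le> B" "I j s" for j s
    using that
  proof (induction "B - j" arbitrary: j s)
    case 0
    then show ?case
      using exit[of s] exec.WhileFalse[of W e s c] unfolding runs_def by (intro exI[of _ 1] exI[of _ s]) simp
  next
    case (Suc d)
    then have j: "j < B" by linarith
    note st = step[OF j Suc.prems(2)]
    then obtain m s' where m: "exec W c s m s'" "m \<le> T" "I (Suc j) s'"
      unfolding runs_def by blast
    have "runs W ((B - Suc j) * Suc T + 1) (While e c) (I B) s'"
      using Suc.hyps(1)[of "Suc j" s'] Suc.hyps(2) j m(3) by auto
    then obtain m' s'' where m': "exec W (While e c) s' m' s''" "m' \<le> (B - Suc j) * Suc T + 1" "I B s''"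
      unfolding runs_def by blast
    have "(B - j) * Suc T = Suc T + (B - Suc j) * Suc T"
      using j by (metis Suc_diff_Suc mult_Suc)
    then have "Suc (m + m') \<le> (B - j) * Suc T + 1"
      using m(2) m'(2) by linarith
    then show ?case
      unfolding runs_def using exec.WhileTrue[of W e s c m s' m' s''] st m m' by blast
  qed
  from this[of 0 s] assms(3) show ?thesis by simp
qed

text \<open>Meant for loop-free and call-free code only: \<open>False\<close> excludes loops and
  calls, which are left to \<open>runs_While\<close> and \<open>runs_Call\<close>. The value
  \<open>0\<close> of \<open>steps\<close> for them is a dummy.\<close>

primrec wp :: "nat \<Rightarrow> com \<Rightarrow> (state \<Rightarrow> bool) \<Rightarrow> state \<Rightarrow> bool" where
  "wp W Skip Q s \<longleftrightarrow> Q s"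
| "wp W (Assign x e) Q s \<longleftrightarrow> fits W e s \<and> Q ((fst s)(x := eval e s), snd s)"
| "wp W (Write a e e') Q s \<longleftrightarrow> fits W e s \<and> fits W e' s \<and>
     Q (fst s, (snd s)(a := (snd s a)(eval e s := eval e' s)))"
| "wp W (Seq c c') Q s \<longleftrightarrow> wp W c (wp W c' Q) s"
| "wp W (Cond e c c') Q s \<longleftrightarrow> fits W e s \<and> (if eval e s \<noteq> 0 then wp W c Q s else wp W c' Q s)"
| "wp W (While e c) Q s \<longleftrightarrow> False"
| "wp W (Call c a b) Q s \<longleftrightarrow> False"

primrec steps :: "com \<Rightarrow> nat" where
  "steps Skip = 1"
| "steps (Assign x e) = 1"
| "steps (Write a e e') = 1"
| "steps (Seq c c') = steps c + steps c'"
| "steps (Cond e c c') = Suc (max (steps c) (steps c'))"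
| "steps (While e c) = 0"
| "steps (Call c a b) = 0"

lemma runs_wp: "wp W c Q s \<Longrightarrow> runs W (steps c) c Q s"
proof (induction c arbitrary: Q s)
  case (Seq c c')
  then have "runs W (steps c) c (wp W c' Q) s" by simp
  from runs_Seq[OF this Seq.IH(2)] show ?case by simp
next
  case (Cond e c c')
  show ?case
  proof (cases "eval e s = 0")
    case True
    then have "runs W (steps c') c' Q s" using Cond by auto
    then obtain m s' where "exec W c' s m s'" "m \<le> steps c'" "Q s'" unfolding runs_def by blast
    then show ?thesis using exec.CondFalse[of W e s c' m s' c] True Cond.prems
      unfolding runs_def by (intro exI[of _ "Suc m"] exI[of _ s']) auto
  next
    case False
    then have "runs W (steps c) c Q s" using Cond by auto
    then obtain m s' where "exec W c s m s'" "m \<le> steps c" "Q s'" unfolding runs_def by blast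
    then show ?thesis using exec.CondTrue[of W e s c m s' c'] False Cond.prems
      unfolding runs_def by (intro exI[of _ "Suc m"] exI[of _ s']) auto
  qed
next
  case Skip
  then show ?case unfolding runs_def using exec.Skip[of W s] by (intro exI[of _ 1] exI[of _ s]) simp
next
  case (Assign x e)
  then show ?case unfolding runs_def using exec.Assign[of W e s x] by (intro exI[of _ 1] exI) auto
next
  case (Write a e e')
  then show ?case unfolding runs_def using exec.Write[of W e s e' a] by (intro exI[of _ 1] exI) auto
qed simp_all

section \<open>Vertex cuts of the query graphs\<close>

text \<open>Every vertex of a path except the first is the head of an edge, so paths are distinct
  lists over a finite set. Finiteness is what makes the \<open>Max\<close> in
  \<open>min_vertex_cut\<close> meaningful.\<close>

lemma finite_vertex_paths:
  assumes "finite E" "s \<noteq> t"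
  shows "finite {p. vertex_path E s t p}"
proof (rule finite_subset)
  have "set p \<subseteq> insert s (snd ` E)" if "successively (\<lambda>u v. (u, v) \<in> E) p" "p \<noteq> []" "hd p = s" for p s
    using that
  proof (induction p arbitrary: s rule: induct_list012)
    case (3 x y zs)
    then have "set (y # zs) \<subseteq> insert y (snd ` E)" "(x, y) \<in> E" by auto
    moreover from this(2) have "y \<in> snd ` E" by force
    ultimately show ?case using 3(5) by auto
  qed auto
  then show "{p. vertex_path E s t p} \<subseteq> {p. set p \<subseteq> insert s (snd ` E) \<and> distinct p}"
    unfolding vertex_path_def by auto
  show "finite {p. set p \<subseteq> insert s (snd ` E) \<and> distinct p}"
    using assms by (intro finite_subset_distinct) auto
qed

lemma finite_disjoint_path_numbers:
  assumes "finite E" "s \<noteq> t"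
  shows "finite {card P | P. internally_disjoint_paths E s t P}"
proof -
  have "{card P | P. internally_disjoint_paths E s t P} \<subseteq> card ` Pow {p. vertex_path E s t p}"
    unfolding internally_disjoint_paths_def by auto
  then show ?thesis
    using finite_vertex_paths[OF assms] by (meson finite_Pow_iff finite_imageI finite_subset)
qed

lemma card_le_min_vertex_cut:
  assumes "finite E" "s \<noteq> t" "internally_disjoint_paths E s t P"
  shows "card P \<le> min_vertex_cut E s t"
  unfolding min_vertex_cut_def
  using finite_disjoint_path_numbers[OF assms(1,2)] assms(3) by (intro Max_ge) auto

text \<open>Choose a vertex of \<open>H\<close> on each path. Distinct paths share only
  \<open>s\<close> and \<open>t\<close>, which are not in \<open>H\<close>, so the choice is
  injective.\<close>

lemma min_vertex_cut_le:
  assumes "finite E" "s \<noteq> t" "finite H" "s \<notin> H" "t \<notin> H"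
    and hit: "\<And>p. vertex_path E s t p \<Longrightarrow> set p \<inter> H \<noteq> {}"
  shows "min_vertex_cut E s t \<le> card H"
proof -
  have "card P \<le> card H" if P: "internally_disjoint_paths E s t P" for P
  proof -
    have path: "vertex_path E s t p" if "p \<in> P" for p
      using P that unfolding internally_disjoint_paths_def by blast
    have "\<forall>p\<in>P. \<exists>x. x \<in> set p \<inter> H" using hit[OF path] by blast
    then obtain h where h: "\<And>p. p \<in> P \<Longrightarrow> h p \<in> set p \<inter> H" by metis
    have "inj_on h P"
    proof (rule inj_onI, rule ccontr)
      fix p q assume pq: "p \<in> P" "q \<in> P" "h p = h q" "p \<noteq> q"
      from h[OF pq(1)] h[OF pq(2)] have "h p \<in> set p \<inter> set q" "h p \<in> H"
        unfolding pq(3) by auto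
      moreover have "set p \<inter> set q \<subseteq> {s, t}"
        using P pq unfolding internally_disjoint_paths_def by blast
      ultimately show False using assms(4,5) by blast
    qed
    then show ?thesis using h by (intro card_inj_on_le[OF _ _ assms(3)]) auto
  qed
  \<comment> \<open>The empty family shows that \<open>Max\<close> is taken over a nonempty
    set.\<close>
  moreover have "internally_disjoint_paths E s t {}"
    by (simp add: internally_disjoint_paths_def)
  ultimately show ?thesis
    unfolding min_vertex_cut_def
    using finite_disjoint_path_numbers[OF assms(1,2)] by (subst Max_le_iff) auto
qed

text \<open>An edge \<open>bd\<close> or \<open>ac\<close> that is missing in the clique instance is present here: it lets \<open>b\<close> or
  \<open>c\<close> be used up by a path of its own, so that only the vertices adjacent to both \<open>a\<close> and \<open>d\<close>
  are left for paths from \<open>a\<close> to \<open>d\<close> of length three.\<close>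

definition query_graph :: "nat \<Rightarrow> (nat \<times> nat) set \<Rightarrow> nat set \<Rightarrow> nat set \<Rightarrow> bool \<Rightarrow> (nat \<times> nat) set" where
  "query_graph n E B C full =
     {(u, v). (u, v) \<in> E \<and> (u \<in> {0..<n} \<and> v \<in> B \<or> u \<in> C \<and> v \<in> {3*n..<4*n} \<or> full \<and> u \<in> B \<and> v \<in> C)
       \<or> (u, v) \<notin> E \<and> (u \<in> {0..<n} \<and> v \<in> C \<or> u \<in> B \<and> v \<in> {3*n..<4*n})}"

text \<open>The set \<open>X\<close> of the overview, restricted to a pair of groups
  \<open>B\<close> and \<open>C\<close>.\<close>

definition separator :: "(nat \<times> nat) set \<Rightarrow> nat set \<Rightarrow> nat set \<Rightarrow> nat \<Rightarrow> nat \<Rightarrow> nat set" where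
  "separator E B C a d = {b\<in>B. (a, b) \<in> E \<and> (b, d) \<notin> E} \<union> {c\<in>C. (a, c) \<notin> E \<and> (c, d) \<in> E}"

context
  fixes n :: nat and E :: "(nat \<times> nat) set" and B C :: "nat set" and a d :: nat
  assumes BC: "B \<subseteq> {n..<2*n}" "C \<subseteq> {2*n..<3*n}"
    and ad: "a \<in> {0..<n}" "d \<in> {3*n..<4*n}"
begin

lemma in_parts: "u \<in> B \<Longrightarrow> n \<le> u \<and> u < 2 * n" "u \<in> C \<Longrightarrow> 2 * n \<le> u \<and> u < 3 * n"
  using BC by auto

text \<open>The parts are numbered consecutively and every arc leads to a later part, hence to a
  larger number. Vertices from \<open>4 * n\<close> on are isolated padding.\<close>

lemma dag_query_graph: "4 * n \<le> N \<Longrightarrow> dag N (query_graph n E B C full)"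
proof -
  assume "4 * n \<le> N"
  then have *: "u < v \<and> v < N" if "(u, v) \<in> query_graph n E B C full" for u v
    using that in_parts[of u] in_parts[of v] by (auto simp: query_graph_def)
  then have "query_graph n E B C full \<subseteq> less_than" by auto
  then have "acyclic (query_graph n E B C full)"
    by (rule acyclic_subset[OF wf_acyclic[OF wf_less_than]])
  moreover have "query_graph n E B C full \<subseteq> {..<N} \<times> {..<N}"
    using * by (fastforce dest: *)
  ultimately show ?thesis unfolding dag_def by blast
qed

lemma finite_query_graph: "finite (query_graph n E B C full)"
  using dag_query_graph[of "4*n" full] unfolding dag_def by (auto intro: finite_subset)

text \<open>One arc of each path of length two is a copied edge and the other comes from a missing
  edge.\<close>

lemma separator_paths:
  "internally_disjoint_paths (query_graph n E B C full) a d ((\<lambda>x. [a, x, d]) ` separator E B C a d)"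
  using BC ad unfolding internally_disjoint_paths_def vertex_path_def
  by (auto simp: separator_def query_graph_def)

lemma finite_parts: "finite B" "finite C"
  using BC finite_subset finite_atLeastLessThan by blast+

lemma finite_separator: "finite (separator E B C a d)"
  using finite_parts by (simp add: separator_def)

lemma separator_notin: "a \<notin> separator E B C a d" "d \<notin> separator E B C a d"
  using BC ad unfolding separator_def by auto

lemma card_separator_paths: "card ((\<lambda>x. [a, x, d]) ` separator E B C a d) = card (separator E B C a d)"
  by (intro card_image inj_onI) auto

lemma card_separator_le: "card (separator E B C a d) \<le> card B + card C"
  unfolding separator_def using finite_parts
  by (intro order_trans[OF card_Un_le] add_mono card_mono) auto

lemma separator_le_cut: "card (separator E B C a d) \<le> min_vertex_cut (query_graph n E B C full) a d"
proof -
  have "a \<noteq> d" using ad by auto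
  then show ?thesis
    using card_le_min_vertex_cut[OF finite_query_graph _ separator_paths] card_separator_paths
    by metis
qed

text \<open>A path has the form \<open>a, x, d\<close> or \<open>a, b, c, d\<close>. The middle
  vertex of the first kind is in the separator; a path of the second kind that avoids it forces
  \<open>bd\<close> and \<open>ac\<close> to be edges, which the assumption forbids. Guarding the
  assumption by \<open>full\<close> covers both query graphs at once: without the arcs from
  \<open>B\<close> to \<open>C\<close> it is vacuous.\<close>

lemma cut_le_separator:
  assumes "\<And>b c. full \<Longrightarrow> b \<in> B \<Longrightarrow> c \<in> C \<Longrightarrow> (a, b) \<in> E \<Longrightarrow> (a, c) \<in> E \<Longrightarrow>
      (b, c) \<in> E \<Longrightarrow> (b, d) \<in> E \<Longrightarrow> (c, d) \<notin> E"
  shows "min_vertex_cut (query_graph n E B C full) a d \<le> card (separator E B C a d)"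
proof (rule min_vertex_cut_le)
  let ?G = "query_graph n E B C full"
  show "a \<noteq> d" using ad by auto
  fix p assume p: "vertex_path ?G a d p"
  \<comment> \<open>Vertices of the last part are sinks, so a path that enters this part ends there,
    at \<open>d\<close>.\<close>
  have no_out: "(v, w) \<notin> ?G" if "v \<in> {3*n..<4*n}" for v w
    using that BC by (auto simp: query_graph_def)
  have last: "y = d" if "successively (\<lambda>u v. (u, v) \<in> ?G) (y # ys)" "last (y # ys) = d"
    "y \<in> {3*n..<4*n}" for y ys
    using that no_out by (cases ys) auto
  \<comment> \<open>There is no arc from \<open>a\<close> to \<open>d\<close>, so the path has an
    inner vertex.\<close>
  obtain x y zs where xy: "p = a # x # y # zs"
  proof -
    obtain q where q: "p = a # q" using p by (cases p) (auto simp: vertex_path_def)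
    with p \<open>a \<noteq> d\<close> obtain x r where r: "q = x # r" by (cases q) (auto simp: vertex_path_def)
    have "x \<noteq> d"
      using p BC ad by (auto simp: q r vertex_path_def query_graph_def)
    with p obtain y zs where "r = y # zs" by (cases r) (auto simp: q r vertex_path_def)
    with q r that show ?thesis by blast
  qed
  have ax: "(a, x) \<in> ?G" and xy': "(x, y) \<in> ?G"
    and suc: "successively (\<lambda>u v. (u, v) \<in> ?G) (y # zs)" and l: "last (y # zs) = d"
    using p unfolding xy vertex_path_def by auto
  consider "x \<in> B" "(a, x) \<in> E" | "x \<in> C" "(a, x) \<notin> E"
    using ax BC ad by (auto simp: query_graph_def)
  then show "set p \<inter> separator E B C a d \<noteq> {}"
  proof cases
    case 2
    then have y: "y \<in> {3*n..<4*n}" "(x, y) \<in> E"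
      using xy' in_parts[of x] in_parts[of y] by (auto simp: query_graph_def)
    from last[OF suc l y(1)] y(2) 2 show ?thesis by (auto simp: xy separator_def)
  next
    case 1
    then consider "y \<in> {3*n..<4*n}" "(x, y) \<notin> E" | "full" "y \<in> C" "(x, y) \<in> E"
      using xy' BC by (fastforce simp: query_graph_def)
    then show ?thesis
    proof cases
      case 1
      with last[OF suc l this(1)] \<open>x \<in> B\<close> \<open>(a, x) \<in> E\<close> show ?thesis by (auto simp: xy separator_def)
    next
      case 2
      have "y \<noteq> d" using 2 BC ad by auto
      with suc l obtain z ws where z: "zs = z # ws" "(y, z) \<in> ?G"
        "successively (\<lambda>u v. (u, v) \<in> ?G) (z # ws)" "last (z # ws) = d"
        by (cases zs) auto
      then have "z \<in> {3*n..<4*n}" "(y, z) \<in> E"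
        using 2(2) z(2) in_parts[of y] in_parts[of z] by (auto simp: query_graph_def)
      with last[OF z(3,4)] have yd: "(y, d) \<in> E" by simp
      show ?thesis
        using assms[of x y] 1 2 yd by (auto simp: xy separator_def)
    qed
  qed
qed (use finite_query_graph finite_separator separator_notin in auto)

text \<open>The edges \<open>bd\<close> and \<open>ac\<close> keep \<open>b\<close> and
  \<open>c\<close> out of the separator, so the path \<open>a, b, c, d\<close> is disjoint from all
  paths of length two and increases their number by one.\<close>

lemma separator_less_cut:
  assumes "b \<in> B" "c \<in> C" "(a, b) \<in> E" "(a, c) \<in> E" "(b, c) \<in> E" "(b, d) \<in> E" "(c, d) \<in> E"
  shows "card (separator E B C a d) < min_vertex_cut (query_graph n E B C True) a d"
proof -
  let ?P = "(\<lambda>x. [a, x, d]) ` separator E B C a d"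
  have bc: "b \<notin> separator E B C a d" "c \<notin> separator E B C a d"
    using assms in_parts[of b] in_parts[of c] by (auto simp: separator_def)
  have "vertex_path (query_graph n E B C True) a d [a, b, c, d]"
    using assms ad in_parts[of b] in_parts[of c] by (auto simp: vertex_path_def query_graph_def)
  then have "internally_disjoint_paths (query_graph n E B C True) a d (insert [a, b, c, d] ?P)"
    using separator_paths[of True] bc separator_notin unfolding internally_disjoint_paths_def
    by auto
  moreover have "card (insert [a, b, c, d] ?P) = Suc (card ?P)"
    using finite_separator by (subst card_insert_disjoint) auto
  moreover have "a \<noteq> d" using ad by auto
  ultimately show ?thesis
    using card_le_min_vertex_cut[OF finite_query_graph] card_separator_paths by (metis Suc_le_eq)
qed

text \<open>The cut without arcs from \<open>B\<close> to \<open>C\<close> is exactly the size of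
  the separator, which is below \<open>k\<close>, so capping at \<open>k\<close> cannot hide an
  increase. The comparison says nothing about the edge \<open>ad\<close>, which is tested
  separately.\<close>

lemma cut_comparison:
  assumes "card B + card C < k"
  shows "min (min_vertex_cut (query_graph n E B C False) a d) k
       < min (min_vertex_cut (query_graph n E B C True) a d) k \<longleftrightarrow>
     (\<exists>b\<in>B. \<exists>c\<in>C. (a, b) \<in> E \<and> (a, c) \<in> E \<and> (b, c) \<in> E \<and> (b, d) \<in> E \<and> (c, d) \<in> E)"
    (is "_ \<longleftrightarrow> ?R")
proof
  assume ?R
  then have "card (separator E B C a d) < min_vertex_cut (query_graph n E B C True) a d"
    using separator_less_cut by blast
  moreover have "min_vertex_cut (query_graph n E B C False) a d \<le> card (separator E B C a d)"
    by (rule cut_le_separator) simp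
  ultimately show "min (min_vertex_cut (query_graph n E B C False) a d) k
       < min (min_vertex_cut (query_graph n E B C True) a d) k"
    using assms card_separator_le by linarith
next
  assume less: "min (min_vertex_cut (query_graph n E B C False) a d) k
       < min (min_vertex_cut (query_graph n E B C True) a d) k"
  show ?R
  proof (rule ccontr)
    assume "\<not> ?R"
    then have "min_vertex_cut (query_graph n E B C True) a d \<le> card (separator E B C a d)"
      by (intro cut_le_separator) blast
    with less separator_le_cut[of False] show False by linarith
  qed
qed

end

section \<open>A DAG with quadratically many nonzero answers\<close>

definition transitive_tournament :: "nat \<Rightarrow> (nat \<times> nat) set" where
  "transitive_tournament n = {(u, v). u < v \<and> v < n}"

lemma dag_transitive_tournament: "dag n (transitive_tournament n)"
proof -
  have "transitive_tournament n \<subseteq> less_than" "acyclic less_than"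
    by (auto simp: transitive_tournament_def intro: wf_acyclic)
  then show ?thesis unfolding dag_def
    by (auto simp: transitive_tournament_def intro: acyclic_subset)
qed

lemma cut_transitive_tournament:
  assumes "s < t" "t < n"
  shows "0 < min_vertex_cut (transitive_tournament n) s t"
proof -
  have "finite (transitive_tournament n)"
    using dag_transitive_tournament[of n] by (auto simp: dag_def intro: finite_subset)
  moreover have "internally_disjoint_paths (transitive_tournament n) s t {[s, t]}"
    using assms by (simp add: internally_disjoint_paths_def vertex_path_def transitive_tournament_def)
  ultimately have "card {[s, t]} \<le> min_vertex_cut (transitive_tournament n) s t"
    using assms by (intro card_le_min_vertex_cut) auto
  then show ?thesis by simp
qed

section \<open>The matrix multiplication exponent is at least one\<close>

lemma run_arith_append: "run_arith (p @ q) vs = run_arith q (run_arith p vs)"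
  by (simp add: run_arith_def)

lemma run_arith_extends: "\<exists>ws. run_arith p vs = vs @ ws \<and> length ws = length p"
proof (induction p rule: rev_induct)
  case (snoc x p)
  then show ?case by (auto simp: run_arith_append) (simp add: run_arith_def)
qed (simp add: run_arith_def)

lemma length_run_arith [simp]: "length (run_arith p vs) = length vs + length p"
  using run_arith_extends[of p vs] by auto

lemma value_at_run_arith: "i < length vs \<Longrightarrow> value_at (run_arith p vs) i = value_at vs i"
  using run_arith_extends[of p vs] by (auto simp: value_at_def nth_append)

section \<open>The schoolbook program for matrix products\<close>

definition mm_input :: "nat \<Rightarrow> (nat \<Rightarrow> nat \<Rightarrow> 'a) \<Rightarrow> (nat \<Rightarrow> nat \<Rightarrow> 'a) \<Rightarrow> 'a list" where
  "mm_input n A B = matrix_entries n A @ matrix_entries n B"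

lemma length_mm_input [simp]: "length (mm_input n A B) = 2 * n * n"
  by (simp add: mm_input_def matrix_entries_def)

lemma entry_index: "i < n \<Longrightarrow> j < n \<Longrightarrow> i * n + j < n * (n :: nat)"
proof -
  assume "i < n" "j < n"
  then have "Suc i * n \<le> n * n" by (intro mult_le_mono1) simp
  with \<open>j < n\<close> show ?thesis by simp
qed

lemma value_at_mm_input:
  assumes "i < n" "j < n"
  shows "value_at (mm_input n A B) (i * n + j) = A i j"
    and "value_at (mm_input n A B) (n * n + (i * n + j)) = B i j"
  using entry_index[OF assms] assms
  by (auto simp: value_at_def mm_input_def matrix_entries_def nth_append)

text \<open>Starting from the constant \<open>0\<close>, each term costs one multiplication and one
  addition. The partial sum of \<open>L\<close> terms therefore sits \<open>2 * L\<close> places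
  after the inputs and the results of \<open>p\<close>.\<close>

lemma inner_product_program:
  fixes p :: "'a::ring_1 arith_op list"
  assumes "i < n" "j < n" "L \<le> n"
  shows "\<exists>q :: 'a arith_op list. length q = 2 * L + 1 \<and>
    (\<forall>A B. value_at (run_arith (p @ q) (mm_input n A B)) (2 * n * n + length p + 2 * L)
       = (\<Sum>l<L. A i l * B l j))"
  using assms(3)
proof (induction L)
  case 0
  show ?case
  proof (intro exI[of _ "[AConst 0]"] conjI allI)
    fix A B :: "nat \<Rightarrow> nat \<Rightarrow> 'a"
    have "run_arith (p @ [AConst 0]) (mm_input n A B) = run_arith p (mm_input n A B) @ [0]"
      by (simp add: run_arith_def)
    then show "value_at (run_arith (p @ [AConst 0]) (mm_input n A B)) (2 * n * n + length p + 2 * 0)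
       = (\<Sum>l<0. A i l * B l j)"
      by (simp add: value_at_def nth_append)
  qed simp
next
  case (Suc L)
  then obtain q :: "'a arith_op list" where q: "length q = 2 * L + 1"
    "\<And>A B. value_at (run_arith (p @ q) (mm_input n A B)) (2 * n * n + length p + 2 * L)
       = (\<Sum>l<L. A i l * B l j)" by auto
  \<comment> \<open>The product lands at offset \<open>2 * L + 1\<close>; it is added to the old sum
    at offset \<open>2 * L\<close>.\<close>
  let ?r = "[AMul (i * n + L) (n * n + (L * n + j)),
    AAdd (2 * n * n + length p + 2 * L) (2 * n * n + length p + (2 * L + 1))]"
  show ?case
  proof (intro exI[of _ "q @ ?r"] conjI allI)
    show "length (q @ ?r) = 2 * Suc L + 1" using q by simp
    fix A B :: "nat \<Rightarrow> nat \<Rightarrow> 'a"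
    define vs where "vs = run_arith (p @ q) (mm_input n A B)"
    have len: "length vs = 2 * n * n + length p + (2 * L + 1)"
      by (simp add: vs_def q(1))
    have "L < n" using Suc by simp
    have m: "value_at vs (i * n + L) = A i L" "value_at vs (n * n + (L * n + j)) = B L j"
      unfolding vs_def
      using value_at_mm_input[of i n L A B] value_at_mm_input[of L n j A B]
        entry_index[of i n L] entry_index[of L n j] assms \<open>L < n\<close>
      by (auto simp: value_at_run_arith)
    have s: "value_at vs (2 * n * n + length p + 2 * L) = (\<Sum>l<L. A i l * B l j)"
      unfolding vs_def by (rule q(2))
    have "run_arith (p @ q @ ?r) (mm_input n A B) = run_arith ?r vs"
      by (simp add: vs_def run_arith_append)
    also have "\<dots> = vs @ [A i L * B L j, (\<Sum>l<Suc L. A i l * B l j)]"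
      using m s len by (simp add: run_arith_def) (simp add: value_at_def nth_append)
    finally show "value_at (run_arith (p @ q @ ?r) (mm_input n A B)) (2 * n * n + length p + 2 * Suc L)
       = (\<Sum>l<Suc L. A i l * B l j)"
      using len by (simp add: value_at_def nth_append)
  qed
qed

text \<open>Entries are computed in row-major order. Since a computation only appends values,
  earlier results keep their positions; the bound on \<open>pos t\<close> is carried along for this
  purpose.\<close>

lemma partial_product_program:
  assumes "m \<le> n * n"
  shows "\<exists>(p :: 'a::ring_1 arith_op list) pos. length p = m * (2 * n + 1) \<and>
    (\<forall>t<m. pos t < 2 * n * n + length p \<and> (\<forall>A B. value_at (run_arith p (mm_input n A B)) (pos t)
       = (\<Sum>l<n. A (t div n) l * B l (t mod n))))"
  using assms
proof (induction m)
  case (Suc m)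
  from Suc.IH[OF Suc_leD[OF Suc.prems]]
  obtain p :: "'a arith_op list" and pos where p: "length p = m * (2 * n + 1)"
    "\<And>t. t < m \<Longrightarrow> pos t < 2 * n * n + length p"
    "\<And>t A B. t < m \<Longrightarrow> value_at (run_arith p (mm_input n A B)) (pos t)
       = (\<Sum>l<n. A (t div n) l * B l (t mod n))" by blast
  have n: "m div n < n" "m mod n < n"
    using Suc.prems by (simp_all add: less_mult_imp_div_less, cases n) auto
  obtain q where q: "length q = 2 * n + 1"
    "\<And>A B. value_at (run_arith (p @ q) (mm_input n A B)) (2 * n * n + length p + 2 * n)
       = (\<Sum>l<n. A (m div n) l * B l (m mod n))"
    using inner_product_program[OF n order_refl, of p] by blast
  let ?pos = "pos(m := 2 * n * n + length p + 2 * n)"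
  show ?case
  proof (intro exI[of _ "p @ q"] exI[of _ ?pos] conjI allI impI)
    show "length (p @ q) = Suc m * (2 * n + 1)" using p(1) q(1) by simp
    fix t assume "t < Suc m"
    then show "?pos t < 2 * n * n + length (p @ q)" using p(2)[of t] q(1) by auto
    fix A B :: "nat \<Rightarrow> nat \<Rightarrow> 'a"
    show "value_at (run_arith (p @ q) (mm_input n A B)) (?pos t)
       = (\<Sum>l<n. A (t div n) l * B l (t mod n))"
    proof (cases "t = m")
      case False
      with \<open>t < Suc m\<close> have "t < m" by simp
      with p(2,3)[OF this] show ?thesis by (simp add: run_arith_append value_at_run_arith)
    qed (simp add: q(2))
  qed
qed auto

text \<open>Makes \<open>3\<close> an admissible exponent, so that the infimum defining
  \<open>mm_exponent\<close> is over a nonempty set.\<close>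

lemma ex_multiplies_matrices: "\<exists>p. multiplies_matrices n p \<and> length p = n * n * (2 * n + 1)"
proof -
  obtain p :: "real arith_op list" and pos where p: "length p = n * n * (2 * n + 1)"
    "\<And>t A B. t < n * n \<Longrightarrow> value_at (run_arith p (mm_input n A B)) (pos t)
       = (\<Sum>l<n. A (t div n) l * B l (t mod n))"
    using partial_product_program[where 'a = real, OF order_refl[of "n * n"]] by blast
  have "value_at (run_arith p (mm_input n A B)) (pos (i * n + j)) = (\<Sum>l<n. A i l * B l j)"
    if "i < n" "j < n" for A B i j
    using p(2)[OF entry_index[OF that]] that by simp
  then have "multiplies_matrices n p"
    unfolding multiplies_matrices_def mm_input_def
    by (intro exI[of _ "\<lambda>i j. pos (i * n + j)"]) blast
  with p(1) show ?thesis by blast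
qed

text \<open>The first row of the product consists of \<open>n\<close> different functions of the matrix entries, none
  of them an input.\<close>

lemma multiplies_matrices_length:
  assumes "multiplies_matrices n p"
  shows "n \<le> length p"
proof -
  obtain pos where pos: "\<And>A B i j. i < n \<Longrightarrow> j < n \<Longrightarrow>
      value_at (run_arith p (mm_input n A B)) (pos i j) = (\<Sum>l<n. A i l * B l j)"
    using assms unfolding multiplies_matrices_def mm_input_def by blast
  have range: "pos 0 j \<in> {2 * n * n..<2 * n * n + length p}" if "j < n" for j
  proof -
    let ?v = "\<lambda>A B. value_at (run_arith p (mm_input n A B)) (pos 0 j)"
    have v: "?v A B = (\<Sum>l<n. A 0 l * B l j)" for A B using pos[of 0 j] that by simp
    \<comment> \<open>If one matrix is all ones and the other zero, the product is zero; an input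
      position in the matrix of ones would carry \<open>1\<close>.\<close>
    have "\<not> pos 0 j < 2 * n * n"
    proof
      assume less: "pos 0 j < 2 * n * n"
      have nth: "(mm_input n A B) ! pos 0 j = (\<Sum>l<n. A 0 l * B l j)" for A B :: "nat \<Rightarrow> nat \<Rightarrow> real"
        using v[of A B] value_at_run_arith[of "pos 0 j" "mm_input n A B" p] less
        by (simp add: value_at_def)
      show False
      proof (cases "pos 0 j < n * n")
        case True
        then show False using nth[of "\<lambda>_ _. 1" "\<lambda>_ _. 0"]
          by (simp add: mm_input_def matrix_entries_def nth_append)
      next
        case False
        then show False using nth[of "\<lambda>_ _. 0" "\<lambda>_ _. 1"] less
          by (simp add: mm_input_def matrix_entries_def nth_append)
      qed
    qed
    \<comment> \<open>Beyond the end \<open>value_at\<close> returns its default \<open>0\<close>,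
      but the product of two all-ones matrices has entries \<open>n\<close>.\<close>
    moreover have "pos 0 j < 2 * n * n + length p"
    proof (rule ccontr)
      assume "\<not> ?thesis"
      then have "?v (\<lambda>_ _. 1) (\<lambda>_ _. 1) = 0" by (simp add: value_at_def)
      with v[of "\<lambda>_ _. 1" "\<lambda>_ _. 1"] that show False by simp
    qed
    ultimately show ?thesis by simp
  qed
  have "inj_on (pos 0) {..<n}"
  proof (rule inj_onI)
    fix j j' assume j: "j \<in> {..<n}" "j' \<in> {..<n}" "pos 0 j = pos 0 j'"
    \<comment> \<open>If the second matrix has ones exactly in column \<open>j\<close>, only column
      \<open>j\<close> of the product is nonzero.\<close>
    then have "(\<Sum>l<n. (1::real) * (if j = j then 1 else 0)) = (\<Sum>l<n. 1 * (if j' = j then 1 else 0))"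
      using pos[of 0 j "\<lambda>_ _. 1" "\<lambda>_ x. if x = j then 1 else 0"]
        pos[of 0 j' "\<lambda>_ _. 1" "\<lambda>_ x. if x = j then 1 else 0"] by auto
    then show "j = j'" using j by (auto split: if_splits)
  qed
  then have "card {..<n} \<le> card {2 * n * n..<2 * n * n + length p}"
    using range by (intro card_inj_on_le[of "pos 0"]) auto
  then show ?thesis by simp
qed

text \<open>Guarantees that the saving \<open>\<epsilon> * mm_exponent\<close> in the exponent is
  positive. An exponent below one would keep a positive power of \<open>n\<close> bounded.\<close>

lemma mm_exponent_ge_1: "1 \<le> mm_exponent"
  unfolding mm_exponent_def
proof (rule cInf_greatest)
  let ?S = "{\<tau>. \<exists>C. \<forall>n\<ge>1. \<exists>p. multiplies_matrices n p \<and> real (length p) \<le> C * real n powr \<tau>}"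
  have "\<exists>p. multiplies_matrices n p \<and> real (length p) \<le> 3 * real n powr 3" if "n \<ge> 1" for n
  proof -
    obtain p where p: "multiplies_matrices n p" "length p = n * n * (2 * n + 1)"
      using ex_multiplies_matrices by blast
    have "length p \<le> n * n * (3 * n)" unfolding p(2) using that by (intro mult_le_mono) auto
    then have "real (length p) \<le> real (n * n * (3 * n))" by (rule of_nat_mono)
    also have "\<dots> = 3 * real n powr 3" using that by (simp add: power3_eq_cube)
    finally show ?thesis using p(1) by blast
  qed
  then have "3 \<in> ?S" by blast
  then show "?S \<noteq> {}" by blast
  fix \<tau> assume "\<tau> \<in> ?S"
  then obtain C where C: "\<And>n. n \<ge> 1 \<Longrightarrow> \<exists>p. multiplies_matrices n p \<and> real (length p) \<le> C * real n powr \<tau>"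
    by blast
  have bound: "real n powr (1 - \<tau>) \<le> C" if n: "n \<ge> 1" for n
  proof -
    from C[OF n] multiplies_matrices_length have "real n \<le> C * real n powr \<tau>"
      by (meson of_nat_le_iff order_trans)
    then show ?thesis using n by (simp add: powr_diff field_simps)
  qed
  show "1 \<le> \<tau>"
  proof (rule ccontr)
    assume "\<not> ?thesis"
    then have t: "0 < 1 - \<tau>" by simp
    obtain n where n: "(\<bar>C\<bar> + 1) powr (1 / (1 - \<tau>)) < real n"
      using reals_Archimedean2 by blast
    then have "((\<bar>C\<bar> + 1) powr (1 / (1 - \<tau>))) powr (1 - \<tau>) < real n powr (1 - \<tau>)"
      using t by (intro powr_less_mono2) auto
    then have "C < real n powr (1 - \<tau>)"
      using t by (simp add: powr_powr)
    moreover have "n \<ge> 1"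
      using n by (cases n) (auto simp: not_less)
    ultimately show False using bound[of n] by simp
  qed
qed

section \<open>The reduction\<close>

abbreviation add_expr (infixl "\<oplus>" 65) where "add_expr \<equiv> Op Add"
abbreviation sub_expr (infixl "\<ominus>" 65) where "sub_expr \<equiv> Op Sub"
abbreviation mul_expr (infixl "\<otimes>" 70) where "mul_expr \<equiv> Op Mul"
abbreviation div_expr (infixl "\<oslash>" 70) where "div_expr \<equiv> Op Div"
abbreviation seq_com (infixr ";;" 55) where "seq_com \<equiv> Seq"

text \<open>Truncated subtraction of two truth values; it also yields \<open>0\<close> when
  \<open>hi < lo\<close>.\<close>

definition in_range :: "expr \<Rightarrow> expr \<Rightarrow> expr \<Rightarrow> expr" where
  "in_range e lo hi = Op Less e hi \<ominus> Op Less e lo"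

lemma eval_in_range [simp]:
  "eval (in_range e lo hi) s = (if eval e s \<in> {eval lo s..<eval hi s} then 1 else 0)"
  by (simp add: in_range_def)

lemma fits_in_range [simp]:
  "1 < W \<Longrightarrow> fits W (in_range e lo hi) s \<longleftrightarrow> fits W e s \<and> fits W lo s \<and> fits W hi s"
  by (auto simp: in_range_def)

lemma fits_in_range_product:
  "1 < W \<Longrightarrow> fits W (in_range e lo hi \<otimes> in_range e' lo' hi') s \<longleftrightarrow>
     fits W (in_range e lo hi) s \<and> fits W (in_range e' lo' hi') s"
  by simp

text \<open>Both products are at most one, so the sum is at most two.\<close>

lemma fits_in_range_sum:
  "2 < W \<Longrightarrow> fits W (in_range x1 lo1 hi1 \<otimes> in_range x2 lo2 hi2 \<oplus> in_range x3 lo3 hi3 \<otimes> in_range x4 lo4 hi4) s \<longleftrightarrow>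
     fits W (in_range x1 lo1 hi1) s \<and> fits W (in_range x2 lo2 hi2) s \<and>
     fits W (in_range x3 lo3 hi3) s \<and> fits W (in_range x4 lo4 hi4) s"
  by simp

text \<open>Registers: \<open>0\<close> holds \<open>n\<close>, \<open>1\<close> the value \<open>k\<close> for graphs with \<open>9 * n\<close> vertices, \<open>2\<close> the size \<open>g\<close> of
  the groups into which the second and the third part are split, \<open>3\<close> the number of groups, \<open>4\<close> the
  counter of the pairs of groups, \<open>5\<close> to \<open>8\<close> the bounds of the two current groups, \<open>9\<close> the counter
  of the inner loops, \<open>10\<close> and \<open>11\<close> a pair of vertices. Arrays: \<open>4\<close> and \<open>5\<close> hold the query graphs
  with and without the edges between the two groups, \<open>6\<close> and \<open>7\<close> the answers.\<close>

abbreviation vertex_count :: expr where "vertex_count \<equiv> Const 9 \<otimes> Var 0"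

text \<open>Here \<open>P\<close> computes the parameter. A data reduction may call an arbitrary
  program on \<open>Control\<close> arrays, which is what permits this call.\<close>

definition prepare :: "com \<Rightarrow> com" where
  "prepare P =
     (Assign 0 (Read 0 (Const 0)) ;; Write 2 (Const 0) vertex_count) ;;
     Call P 2 3 ;;
     Assign 1 (Read 3 (Const 0)) ;;
     Assign 2 ((Var 1 \<ominus> Const 1) \<oslash> Const 2) ;;
     Assign 3 (Var 0 \<oslash> Var 2 \<oplus> Const 1) ;;
     Write 4 (Const 0) vertex_count ;;
     Write 4 (Const 1) (Var 1) ;;
     Write 5 (Const 0) vertex_count ;;
     Write 5 (Const 1) (Var 1)"

text \<open>The counter encodes a pair of group numbers as quotient and remainder. With truncated
  subtraction \<open>x - (x - y)\<close> is \<open>min x y\<close>, which clips a group at the end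
  of its part.\<close>

definition select_groups :: com where
  "select_groups =
     Assign 5 (Var 0 \<oplus> Var 4 \<oslash> Var 3 \<otimes> Var 2) ;;
     Assign 6 (Const 2 \<otimes> Var 0 \<ominus> (Const 2 \<otimes> Var 0 \<ominus> (Var 5 \<oplus> Var 2))) ;;
     Assign 7 (Const 2 \<otimes> Var 0 \<oplus> Op Mod (Var 4) (Var 3) \<otimes> Var 2) ;;
     Assign 8 (Const 3 \<otimes> Var 0 \<ominus> (Const 3 \<otimes> Var 0 \<ominus> (Var 7 \<oplus> Var 2))) ;;
     Assign 9 (Const 0)"

definition adjacency :: expr where
  "adjacency = Read 0 (Const 1 \<oplus> Var 10 \<otimes> (Const 4 \<otimes> Var 0) \<oplus> Var 11)"

text \<open>Products and sums of truth values stand for conjunctions and disjunctions.\<close>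

definition copied :: expr where
  "copied = in_range (Var 10) (Const 0) (Var 0) \<otimes> in_range (Var 11) (Var 5) (Var 6)
     \<oplus> in_range (Var 10) (Var 7) (Var 8) \<otimes> in_range (Var 11) (Const 3 \<otimes> Var 0) (Const 4 \<otimes> Var 0)"

definition complemented :: expr where
  "complemented = in_range (Var 10) (Const 0) (Var 0) \<otimes> in_range (Var 11) (Var 7) (Var 8)
     \<oplus> in_range (Var 10) (Var 5) (Var 6) \<otimes> in_range (Var 11) (Const 3 \<otimes> Var 0) (Const 4 \<otimes> Var 0)"

definition between :: expr where
  "between = in_range (Var 10) (Var 5) (Var 6) \<otimes> in_range (Var 11) (Var 7) (Var 8)"

definition write_entries :: "expr \<Rightarrow> expr \<Rightarrow> com" where
  "write_entries e e' = Write 4 (Var 9 \<oplus> Const 2) e ;; Write 5 (Var 9 \<oplus> Const 2) e'"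

text \<open>The choice of the case depends on \<open>n\<close> and counters only, and each case
  writes a copy, a complement or a constant, as \<open>query_expr\<close> demands. Zeros are written
  explicitly to erase the query for the previous pair of groups.\<close>

definition build_entry :: com where
  "build_entry =
     Assign 10 (Var 9 \<oslash> vertex_count) ;;
     Assign 11 (Op Mod (Var 9) vertex_count) ;;
     Cond copied (write_entries adjacency adjacency)
       (Cond complemented (write_entries (Const 1 \<ominus> adjacency) (Const 1 \<ominus> adjacency))
          (Cond between (write_entries adjacency (Const 0)) (write_entries (Const 0) (Const 0)))) ;;
     Assign 9 (Var 9 \<oplus> Const 1)"

definition answer_index :: expr where
  "answer_index = Var 10 \<otimes> vertex_count \<oplus> Var 11"

definition test_pair :: com where
  "test_pair =
     Assign 10 (Var 9 \<oslash> Var 0) ;;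
     Assign 11 (Const 3 \<otimes> Var 0 \<oplus> Op Mod (Var 9) (Var 0)) ;;
     Cond (Op Eq (Const 1) adjacency)
       (Cond (Op Less (Read 7 answer_index) (Read 6 answer_index)) (Write 1 (Const 0) (Const 1)) Skip)
       Skip ;;
     Assign 9 (Var 9 \<oplus> Const 1)"

definition process_groups :: "com \<Rightarrow> com" where
  "process_groups P =
     select_groups ;;
     While (Op Less (Var 9) (vertex_count \<otimes> vertex_count)) build_entry ;;
     Call P 4 6 ;;
     Call P 5 7 ;;
     Assign 9 (Const 0) ;;
     While (Op Less (Var 9) (Var 0 \<otimes> Var 0)) test_pair ;;
     Assign 4 (Var 4 \<oplus> Const 1)"

definition clique_program :: "com \<Rightarrow> com \<Rightarrow> com" where
  "clique_program P\<^sub>k P = prepare P\<^sub>k ;; While (Op Less (Var 4) (Var 3 \<otimes> Var 3)) (process_groups P)"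

definition reduction_roles :: "nat \<Rightarrow> role" where
  "reduction_roles a = (if a = 0 then Input else if a = 1 then Output else if a \<in> {4, 5} then Query
     else if a \<in> {6, 7} then Result else Control)"

lemma data_reduction_clique_program: "data_reduction reduction_roles P (clique_program P\<^sub>k P)"
proof -
  let ?r = reduction_roles
  have roles: "?r 0 = Input" "?r 1 = Output" "?r 2 = Control" "?r 3 = Control" "?r 4 = Query"
    "?r 5 = Query" "?r 6 = Result" "?r 7 = Result"
    by (simp_all add: reduction_roles_def)
  have ctrl: "control_expr ?r copied" "control_expr ?r complemented" "control_expr ?r between"
    "control_expr ?r answer_index"
    by (simp_all add: copied_def complemented_def between_def in_range_def answer_index_def)
  have adj: "query_expr ?r adjacency" "query_expr ?r (Const 1 \<ominus> adjacency)" "test_operand ?r adjacency"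
    unfolding adjacency_def
    by (rule query_expr.intros(2) query_expr.intros(3) test_operand.intros(2);
        simp add: roles del: One_nat_def)+
  have const: "query_expr ?r (Const c)" for c by (rule query_expr.intros(1)) simp
  have entries: "data_reduction ?r P (write_entries e e')" if "query_expr ?r e" "query_expr ?r e'" for e e'
    unfolding write_entries_def
    by (intro data_reduction.intros(5) data_reduction.intros(4)) (simp_all add: roles that)
  have build: "data_reduction ?r P build_entry"
    unfolding build_entry_def
    by (intro data_reduction.intros(5) data_reduction.intros(2) data_reduction.intros(6) entries)
      (simp_all add: ctrl adj const del: One_nat_def)
  have test: "acceptance_test ?r (Cond (Op Eq (Const 1) adjacency)
       (Cond (Op Less (Read 7 answer_index) (Read 6 answer_index)) (Write 1 (Const 0) (Const 1)) Skip)
       Skip)"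
    by (intro acceptance_test.intros adj test_operand.intros(2), simp_all add: roles ctrl del: One_nat_def)
      (intro test_operand.intros(1), simp)
  have pair: "data_reduction ?r P test_pair"
    unfolding test_pair_def
    by (intro data_reduction.intros(5) data_reduction.intros(2) data_reduction.intros(10)[OF test]) simp_all
  have groups: "data_reduction ?r P (process_groups P)"
    unfolding process_groups_def select_groups_def
    by (intro data_reduction.intros(5) data_reduction.intros(2) data_reduction.intros(7) build pair
        data_reduction.intros(9)) (simp_all add: roles)
  have control_write: "data_reduction ?r P (Write a e e')"
    if "a \<in> {2, 4, 5}" "control_expr ?r e" "control_expr ?r e'" for a e e'
  proof (cases "?r a = Control")
    case True
    then show ?thesis using that(2,3) by (rule data_reduction.intros(3))
  next
    case False
    with that(1) roles have "?r a = Query" by auto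
    then show ?thesis using that(2) query_expr.intros(1)[OF that(3)] by (rule data_reduction.intros(4))
  qed
  have "data_reduction ?r P (prepare P\<^sub>k)"
    unfolding prepare_def
    by (intro data_reduction.intros(5) data_reduction.intros(2) control_write data_reduction.intros(8))
      (simp_all add: roles)
  then show ?thesis
    unfolding clique_program_def
    by (intro data_reduction.intros(5) data_reduction.intros(7) groups) simp_all
qed

section \<open>Splitting the two middle parts into groups\<close>

text \<open>Two groups together have at most \<open>k - 1\<close> vertices. The size is positive
  only for \<open>k \<ge> 3\<close>.\<close>

definition group_size :: "nat \<Rightarrow> nat" where
  "group_size k = (k - 1) div 2"

definition group_count :: "nat \<Rightarrow> nat \<Rightarrow> nat" where
  "group_count n k = n div group_size k + 1"

definition second_lo :: "nat \<Rightarrow> nat \<Rightarrow> nat \<Rightarrow> nat" where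
  "second_lo n k l = n + l div group_count n k * group_size k"

definition third_lo :: "nat \<Rightarrow> nat \<Rightarrow> nat \<Rightarrow> nat" where
  "third_lo n k l = 2 * n + l mod group_count n k * group_size k"

definition second_group :: "nat \<Rightarrow> nat \<Rightarrow> nat \<Rightarrow> nat set" where
  "second_group n k l = {second_lo n k l..<min (2 * n) (second_lo n k l + group_size k)}"

definition third_group :: "nat \<Rightarrow> nat \<Rightarrow> nat \<Rightarrow> nat set" where
  "third_group n k l = {third_lo n k l..<min (3 * n) (third_lo n k l + group_size k)}"

lemma groups_subset: "second_group n k l \<subseteq> {n..<2*n}" "third_group n k l \<subseteq> {2*n..<3*n}"
  by (auto simp: second_group_def third_group_def second_lo_def third_lo_def)

lemma card_groups_less:
  assumes "0 < k"
  shows "card (second_group n k l) + card (third_group n k l) < k"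
proof -
  have "card (second_group n k l) \<le> group_size k" "card (third_group n k l) \<le> group_size k"
    by (auto simp: second_group_def third_group_def second_lo_def third_lo_def)
  then show ?thesis using assms by (auto simp: group_size_def)
qed

lemma groups_cover:
  assumes "b \<in> {n..<2*n}" "c \<in> {2*n..<3*n}" "3 \<le> k"
  shows "\<exists>l < group_count n k * group_count n k. b \<in> second_group n k l \<and> c \<in> third_group n k l"
proof -
  let ?g = "group_size k" and ?G = "group_count n k"
  have g: "0 < ?g" using assms by (simp add: group_size_def)
  define i j where "i = (b - n) div ?g" and "j = (c - 2 * n) div ?g"
  have ij: "i < ?G" "j < ?G"
    using assms by (auto simp: i_def j_def group_count_def less_Suc_eq_le intro!: div_le_mono)
  have eq: "b = n + i * ?g + (b - n) mod ?g" "c = 2 * n + j * ?g + (c - 2 * n) mod ?g"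
    using assms by (auto simp: i_def j_def)
  have mod: "(b - n) mod ?g < ?g" "(c - 2 * n) mod ?g < ?g" using g by auto
  have "b < n + i * ?g + ?g" "c < 2 * n + j * ?g + ?g"
    using eq mod by linarith+
  moreover have "n + i * ?g \<le> b" "2 * n + j * ?g \<le> c"
    using eq by linarith+
  \<comment> \<open>The group numbers are the quotients of the offsets by the group size;
    \<open>i * ?G + j\<close> is the counter value that decodes to this pair.\<close>
  ultimately have "b \<in> second_group n k (i * ?G + j)" "c \<in> third_group n k (i * ?G + j)"
    using ij assms by (simp_all add: second_group_def third_group_def second_lo_def third_lo_def)
  moreover have "i * ?G + j < ?G * ?G"
  proof -
    have "Suc i * ?G \<le> ?G * ?G" using ij by (intro mult_le_mono1) simp
    then show ?thesis using ij by simp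
  qed
  ultimately show ?thesis by blast
qed

definition clique_through :: "nat \<Rightarrow> nat \<Rightarrow> (nat \<times> nat) set \<Rightarrow> nat \<Rightarrow> nat \<Rightarrow> nat \<Rightarrow> bool" where
  "clique_through n k E l a d \<longleftrightarrow> (a, d) \<in> E \<and> (\<exists>b\<in>second_group n k l. \<exists>c\<in>third_group n k l.
     (a, b) \<in> E \<and> (a, c) \<in> E \<and> (b, c) \<in> E \<and> (b, d) \<in> E \<and> (c, d) \<in> E)"

definition group_clique :: "nat \<Rightarrow> nat \<Rightarrow> (nat \<times> nat) set \<Rightarrow> nat \<Rightarrow> bool" where
  "group_clique n k E l \<longleftrightarrow> (\<exists>a\<in>{0..<n}. \<exists>d\<in>{3*n..<4*n}. clique_through n k E l a d)"

lemma four_clique_iff_group_clique: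
  assumes "3 \<le> k"
  shows "has_four_clique n E \<longleftrightarrow> (\<exists>l < group_count n k * group_count n k. group_clique n k E l)"
proof
  assume "has_four_clique n E"
  then obtain a b c d where *: "a \<in> {0..<n}" "b \<in> {n..<2*n}" "c \<in> {2*n..<3*n}" "d \<in> {3*n..<4*n}"
    "(a, b) \<in> E" "(a, c) \<in> E" "(a, d) \<in> E" "(b, c) \<in> E" "(b, d) \<in> E" "(c, d) \<in> E"
    unfolding has_four_clique_def by blast
  from groups_cover[OF *(2,3) assms] obtain l where "l < group_count n k * group_count n k"
    "b \<in> second_group n k l" "c \<in> third_group n k l" by blast
  with * show "\<exists>l < group_count n k * group_count n k. group_clique n k E l"
    unfolding group_clique_def clique_through_def by blast
next
  assume "\<exists>l < group_count n k * group_count n k. group_clique n k E l"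
  then show "has_four_clique n E"
    using groups_subset unfolding has_four_clique_def group_clique_def clique_through_def by blast
qed

section \<open>Invariants and correctness of the reduction\<close>

text \<open>What preparation establishes and all later loops preserve. The zeros beyond the matrix
  are included because the subroutine is specified only for arrays that equal
  \<open>apmc_input\<close> everywhere.\<close>

definition frame :: "nat \<Rightarrow> nat \<Rightarrow> (nat \<times> nat) set \<Rightarrow> state \<Rightarrow> bool" where
  "frame n k E s \<longleftrightarrow> fst s 0 = n \<and> fst s 1 = k \<and> fst s 2 = group_size k \<and> fst s 3 = group_count n k \<and>
     snd s 0 = clique_input n E \<and>
     (\<forall>a\<in>{4, 5}. snd s a 0 = 9 * n \<and> snd s a 1 = k \<and>
        (\<forall>i \<ge> (9 * n) * (9 * n). snd s a (i + 2) = 0))"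

context
  fixes n k W :: nat and E :: "(nat \<times> nat) set"
  assumes n: "1 \<le> n" and k: "3 \<le> k" "k \<le> 9 * n"
    and W: "200 * (n * n) + 400 * n + 200 \<le> W"
begin

lemma group_size_bounds: "1 \<le> group_size k" "2 * group_size k < k"
  using k by (auto simp: group_size_def)

lemma group_count_bounds: "1 \<le> group_count n k" "group_count n k \<le> n + 1"
  "i < group_count n k \<Longrightarrow> i * group_size k \<le> n"
proof -
  show "1 \<le> group_count n k" "group_count n k \<le> n + 1"
    by (auto simp: group_count_def)
  assume "i < group_count n k"
  then have "i * group_size k \<le> n div group_size k * group_size k"
    by (intro mult_le_mono1) (simp add: group_count_def)
  also have "\<dots> \<le> n" by simp
  finally show "i * group_size k \<le> n" .
qed

lemma group_count_square: "group_count n k * group_count n k \<le> n * n + 2 * n + 1"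
  using mult_le_mono[OF group_count_bounds(2) group_count_bounds(2)] by simp

lemma wp_prepare_initial:
  "wp W (Assign 0 (Read 0 (Const 0)) ;; Write 2 (Const 0) vertex_count)
     (\<lambda>s. fst s 0 = n \<and> snd s 2 = (\<lambda>i. if i = 0 then 9 * n else 0) \<and> snd s 0 = clique_input n E \<and>
        fst s 4 = 0 \<and> snd s 1 0 = 0 \<and> (\<forall>i. snd s 4 i = 0 \<and> snd s 5 i = 0))
     (start (clique_input n E))"
proof -
  have "clique_input n E 0 = n" by (simp add: clique_input_def)
  then show ?thesis using W by (auto simp: start_def)
qed

definition outer_inv :: "nat \<Rightarrow> state \<Rightarrow> bool" where
  "outer_inv l s \<longleftrightarrow> frame n k E s \<and> fst s 4 = l \<and>
     snd s 1 0 = (if \<exists>l'<l. group_clique n k E l' then 1 else 0)"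

lemma runs_prepare:
  assumes "computes_within W P (\<lambda>i. if i = 0 then 9 * n else 0) T (\<lambda>out. out 0 = k)"
  shows "runs W (nat \<lfloor>T\<rfloor> + 10) (prepare P) (outer_inv 0) (start (clique_input n E))"
proof -
  let ?mid = "\<lambda>s. fst s 0 = n \<and> snd s 0 = clique_input n E \<and>
        fst s 4 = 0 \<and> snd s 1 0 = 0 \<and> (\<forall>i. snd s 4 i = 0 \<and> snd s 5 i = 0)"
  let ?rest = "Assign 1 (Read 3 (Const 0)) ;;
     Assign 2 ((Var 1 \<ominus> Const 1) \<oslash> Const 2) ;;
     Assign 3 (Var 0 \<oslash> Var 2 \<oplus> Const 1) ;;
     Write 4 (Const 0) vertex_count ;;
     Write 4 (Const 1) (Var 1) ;;
     Write 5 (Const 0) vertex_count ;;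
     Write 5 (Const 1) (Var 1)"
  have rest: "runs W (steps ?rest) ?rest (outer_inv 0) s" if s: "?mid s" "snd s 3 0 = k" for s
  proof (rule runs_wp)
    have [simp]: "(k - Suc 0) div 2 = group_size k" "n div group_size k = group_count n k - 1"
      by (simp_all add: group_size_def group_count_def)
    have "k < W" "2 < W" "9 * n < W" "group_size k < W" "group_count n k < W"
      using W k group_size_bounds group_count_bounds(1,2) by linarith+
    then show "wp W ?rest (outer_inv 0) s"
      using group_count_bounds(1) n s(1)
      by (simp add: outer_inv_def frame_def s(2) less_imp_diff_less)
  qed
  have call: "runs W (Suc (nat \<lfloor>T\<rfloor>)) (Call P 2 3) (\<lambda>s. ?mid s \<and> snd s 3 0 = k) s"
    if "?mid s" "snd s 2 = (\<lambda>i. if i = 0 then 9 * n else 0)" for s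
    using that assms by (intro runs_Call) auto
  have "runs W (2 + (Suc (nat \<lfloor>T\<rfloor>) + steps ?rest)) (prepare P) (outer_inv 0) (start (clique_input n E))"
    unfolding prepare_def
  proof (rule runs_Seq)
    from runs_wp[OF wp_prepare_initial]
    show "runs W 2 (Assign 0 (Read 0 (Const 0)) ;; Write 2 (Const 0) vertex_count)
      (\<lambda>s. ?mid s \<and> snd s 2 = (\<lambda>i. if i = 0 then 9 * n else 0)) (start (clique_input n E))"
      by (rule runs_mono) auto
    show "runs W (Suc (nat \<lfloor>T\<rfloor>) + steps ?rest) (Call P 2 3 ;; ?rest) (outer_inv 0) s"
      if "?mid s \<and> snd s 2 = (\<lambda>i. if i = 0 then 9 * n else 0)" for s
      using that by (intro runs_Seq[OF call rest]) auto
  qed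
  then show ?thesis by (rule runs_mono) auto
qed

definition build_inv :: "nat \<Rightarrow> nat \<Rightarrow> state \<Rightarrow> bool" where
  "build_inv l m s \<longleftrightarrow> outer_inv l s \<and> fst s 9 = m \<and>
     fst s 5 = second_lo n k l \<and> fst s 6 = min (2 * n) (second_lo n k l + group_size k) \<and>
     fst s 7 = third_lo n k l \<and> fst s 8 = min (3 * n) (third_lo n k l + group_size k) \<and>
     (\<forall>i<m. snd s 4 (i + 2) = (if (i div (9 * n), i mod (9 * n)) \<in>
        query_graph n E (second_group n k l) (third_group n k l) True then 1 else 0)) \<and>
     (\<forall>i<m. snd s 5 (i + 2) = (if (i div (9 * n), i mod (9 * n)) \<in>
        query_graph n E (second_group n k l) (third_group n k l) False then 1 else 0))"

lemma lo_bounds: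
  assumes "l < group_count n k * group_count n k"
  shows "n \<le> second_lo n k l" "second_lo n k l \<le> 2 * n"
    "2 * n \<le> third_lo n k l" "third_lo n k l \<le> 3 * n"
proof -
  have "l div group_count n k < group_count n k" "l mod group_count n k < group_count n k"
    using assms group_count_bounds(1) by (simp_all add: less_mult_imp_div_less)
  from this[THEN group_count_bounds(3)]
  show "n \<le> second_lo n k l" "second_lo n k l \<le> 2 * n"
    "2 * n \<le> third_lo n k l" "third_lo n k l \<le> 3 * n"
    by (simp_all add: second_lo_def third_lo_def)
qed

lemma runs_select_groups:
  assumes l: "l < group_count n k * group_count n k" and s: "outer_inv l s"
  shows "runs W (steps select_groups) select_groups (build_inv l 0) s"
proof (rule runs_wp)
  have f: "fst s 0 = n" "fst s 2 = group_size k" "fst s 3 = group_count n k" "fst s 4 = l"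
    using s by (auto simp: outer_inv_def frame_def)
  have b: "l < W" "n < W" "2 * n < W" "3 * n < W" "1 < W" "2 < W" "3 < W" "group_size k < W" "group_count n k < W"
    "second_lo n k l + group_size k < W" "third_lo n k l + group_size k < W"
    using l group_count_square W k group_size_bounds group_count_bounds lo_bounds[OF l] by linarith+
  have q: "n + l div group_count n k * group_size k = second_lo n k l"
    "2 * n + l mod group_count n k * group_size k = third_lo n k l"
    by (simp_all add: second_lo_def third_lo_def)
  have c: "l div group_count n k < W" "l mod group_count n k < W"
    "l div group_count n k * group_size k < W" "l mod group_count n k * group_size k < W"
    "second_lo n k l < W" "third_lo n k l < W"
    using b q div_le_dividend[of l "group_count n k"] mod_less_eq_dividend[of l "group_count n k"] by linarith+
  have m: "x - (x - y) = min x y" for x y :: nat by simp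
  from s have "outer_inv l ((fst s)(5 := a, 6 := b, 7 := c, 8 := d, 9 := e), snd s)" for a b c d e
    by (simp add: outer_inv_def frame_def)
  with f b c show "wp W select_groups (build_inv l 0) s"
    by (simp add: select_groups_def build_inv_def m q less_imp_diff_less min.strict_coboundedI1)
qed

lemma adjacency_value:
  assumes "fst s 0 = n" "fst s 10 = u" "fst s 11 = v" "snd s 0 = clique_input n E" "u < 4 * n" "v < 4 * n"
  shows "eval adjacency s = (if (u, v) \<in> E then 1 else 0)" "fits W adjacency s"
proof -
  have "Suc u * (4 * n) \<le> 4 * n * (4 * n)"
    using assms by (intro mult_le_mono1) simp
  then have i: "u * (4 * n) + v < 4 * n * (4 * n)" using assms by simp
  have "(u * (4 * n) + v) div (4 * n) = u" "(u * (4 * n) + v) mod (4 * n) = v"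
    using assms by auto
  with i show e: "eval adjacency s = (if (u, v) \<in> E then 1 else 0)"
    by (simp add: adjacency_def assms clique_input_def)
  have "4 * n < W" "1 < W" "4 < W" "n < W" "u * (4 * n) + v + 1 < W" using i W by linarith+
  then show "fits W adjacency s"
    using e assms by (simp add: adjacency_def)
qed

lemma runs_build_entry:
  assumes l: "l < group_count n k * group_count n k" and m: "m < 9 * n * (9 * n)"
    and s: "build_inv l m s"
  shows "runs W (steps build_entry) build_entry (build_inv l (Suc m)) s"
proof (rule runs_wp)
  let ?B = "second_group n k l" and ?C = "third_group n k l"
  define u v where "u = m div (9 * n)" and "v = m mod (9 * n)"
  define x where "x full = (if (u, v) \<in> query_graph n E ?B ?C full then 1 else (0::nat))" for full
  define s' where "s' = (fst s)(10 := u, 11 := v)"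
  have f: "fst s 0 = n" "fst s 9 = m" "fst s 5 = second_lo n k l"
    "fst s 6 = min (2 * n) (second_lo n k l + group_size k)"
    "fst s 7 = third_lo n k l" "fst s 8 = min (3 * n) (third_lo n k l + group_size k)"
    "snd s 0 = clique_input n E"
    using s by (auto simp: build_inv_def outer_inv_def frame_def)
  have uv: "u < 9 * n" "v < 9 * n"
    using m n by (auto simp: u_def v_def less_mult_imp_div_less)
  have b: "m + 2 < W" "1 < W" "2 < W" "3 < W" "4 < W" "9 < W" "9 * n < W" "4 * n < W" "3 * n < W" "2 * n < W" "n < W" "m < W" "u < W" "v < W" "Suc m < W"
    "second_lo n k l < W" "third_lo n k l < W"
    using m uv W lo_bounds[OF l] by linarith+
  have fits: "fits W copied (s', snd s)" "fits W complemented (s', snd s)" "fits W between (s', snd s)"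
    unfolding copied_def complemented_def between_def
    using b by (simp_all only: fits_in_range_product fits_in_range_sum)
      (simp_all add: s'_def f min.strict_coboundedI1)
  have vals: "eval copied (s', snd s) \<noteq> 0 \<longleftrightarrow> u < n \<and> v \<in> ?B \<or> u \<in> ?C \<and> v \<in> {3*n..<4*n}"
    "eval complemented (s', snd s) \<noteq> 0 \<longleftrightarrow> u < n \<and> v \<in> ?C \<or> u \<in> ?B \<and> v \<in> {3*n..<4*n}"
    "eval between (s', snd s) \<noteq> 0 \<longleftrightarrow> u \<in> ?B \<and> v \<in> ?C"
    by (simp_all add: copied_def complemented_def between_def s'_def f second_group_def third_group_def)
  have parts: "w \<in> ?B \<Longrightarrow> n \<le> w \<and> w < 2 * n" "w \<in> ?C \<Longrightarrow> 2 * n \<le> w \<and> w < 3 * n" for w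
    using groups_subset[of n k l] by auto
  let ?upd = "\<lambda>x y. (snd s)(4 := (snd s 4)(m + 2 := x), 5 := (snd s 5)(m + 2 := y))"
  have inv: "build_inv l (Suc m) (s'(9 := Suc m), ?upd (x True) (x False))"
    using s m by (simp add: build_inv_def outer_inv_def frame_def s'_def x_def u_def v_def less_Suc_eq)
  have s'_regs: "s' 9 = m" "s' 0 = n" "s' 10 = u" "s' 11 = v"
    by (simp_all add: s'_def f)
  \<comment> \<open>The second write sees a changed query array. So the values of both expressions
    are required in all states that agree on registers and input.\<close>
  have written: "wp W (write_entries e e') Q (s', snd s) \<longleftrightarrow> Q (s', ?upd y z)"
    if "\<And>t. fst t = s' \<Longrightarrow> snd t 0 = clique_input n E \<Longrightarrow> fits W e t \<and> eval e t = y"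
      "\<And>t. fst t = s' \<Longrightarrow> snd t 0 = clique_input n E \<Longrightarrow> fits W e' t \<and> eval e' t = z" for e e' y z Q
    using that b by (simp add: write_entries_def s'_regs f)
  have adj: "fits W adjacency t \<and> eval adjacency t = (if (u, v) \<in> E then 1 else 0)"
    if "u < 4 * n" "v < 4 * n" "fst t = s'" "snd t 0 = clique_input n E" for t
    using adjacency_value[of t u v] that by (simp add: s'_regs)
  have const: "fits W (Const 0) t \<and> eval (Const 0) t = 0" for t using b by simp
  \<comment> \<open>Whichever branch is taken, the values written are the two adjacency bits
    \<open>x True\<close> and \<open>x False\<close>.\<close>
  have "wp W (Cond copied (write_entries adjacency adjacency)
       (Cond complemented (write_entries (Const 1 \<ominus> adjacency) (Const 1 \<ominus> adjacency))
          (Cond between (write_entries adjacency (Const 0)) (write_entries (Const 0) (Const 0)))))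
      Q (s', snd s) \<longleftrightarrow> Q (s', ?upd (x True) (x False))" for Q
  proof -
    consider (copied) "eval copied (s', snd s) \<noteq> 0"
      | (compl) "eval copied (s', snd s) = 0" "eval complemented (s', snd s) \<noteq> 0"
      | (between) "eval copied (s', snd s) = 0" "eval complemented (s', snd s) = 0"
          "eval between (s', snd s) \<noteq> 0"
      | (other) "eval copied (s', snd s) = 0" "eval complemented (s', snd s) = 0"
          "eval between (s', snd s) = 0"
      by blast
    then show ?thesis
    proof cases
      case copied
      then have c: "u < n \<and> v \<in> ?B \<or> u \<in> ?C \<and> v \<in> {3*n..<4*n}" using vals by blast
      then have bound: "u < 4 * n" "v < 4 * n"
        using parts[of u] parts[of v] by auto
      from c have "x full = (if (u, v) \<in> E then 1 else 0)" for full
        using parts[of u] parts[of v] by (auto simp: x_def query_graph_def)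
      with copied show ?thesis
        using fits by (simp add: written[OF adj adj] bound)
    next
      case compl
      then have c: "u < n \<and> v \<in> ?C \<or> u \<in> ?B \<and> v \<in> {3*n..<4*n}" using vals by blast
      then have bound: "u < 4 * n" "v < 4 * n"
        using parts[of u] parts[of v] by auto
      from c have x: "x full = (if (u, v) \<in> E then 0 else 1)" for full
        using parts[of u] parts[of v] by (auto simp: x_def query_graph_def)
      have "fits W (Const 1 \<ominus> adjacency) t \<and> eval (Const 1 \<ominus> adjacency) t = (if (u, v) \<in> E then 0 else 1)"
        if "fst t = s'" "snd t 0 = clique_input n E" for t
        using adj[OF bound that] b by simp
      with compl show ?thesis
        using fits by (simp add: written x del: One_nat_def fits.simps eval.simps)
    next
      case between
      then have c: "u \<in> ?B \<and> v \<in> ?C" using vals by blast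
      then have bound: "u < 4 * n" "v < 4 * n"
        using parts[of u] parts[of v] by auto
      from c have "x True = (if (u, v) \<in> E then 1 else 0)" "x False = 0"
        using parts[of u] parts[of v] by (auto simp: x_def query_graph_def)
      with between show ?thesis
        using fits by (simp add: written[OF adj const] bound)
    next
      case other
      then have "x full = 0" for full
        using vals by (auto simp: x_def query_graph_def)
      with other show ?thesis
        using fits by (simp add: written[OF const const])
    qed
  qed
  with inv s'_regs show "wp W build_entry (build_inv l (Suc m)) s"
    using b unfolding build_entry_def
    by (simp add: f s'_def[symmetric] u_def[symmetric] v_def[symmetric])
qed

lemma runs_build:
  assumes l: "l < group_count n k * group_count n k" and s: "build_inv l 0 s"
  shows "runs W (9 * n * (9 * n) * Suc (steps build_entry) + 1)
    (While (Op Less (Var 9) (vertex_count \<otimes> vertex_count)) build_entry)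
    (build_inv l (9 * n * (9 * n))) s"
proof (rule runs_While)
  have "9 * n * (9 * n) < W" "9 * n < W" "9 < W" "n < W" "1 < W" using W by linarith+
  note b = this
  have f: "fst t 0 = n" "fst t 9 = m" if "build_inv l m t" for m t
    using that by (auto simp: build_inv_def outer_inv_def frame_def)
  show "fits W (Op Less (Var 9) (vertex_count \<otimes> vertex_count)) t \<and>
      eval (Op Less (Var 9) (vertex_count \<otimes> vertex_count)) t \<noteq> 0 \<and>
      runs W (steps build_entry) build_entry (build_inv l (Suc m)) t"
    if "m < 9 * n * (9 * n)" "build_inv l m t" for m t
    using runs_build_entry[OF l that] f[OF that(2)] b that(1) by simp
  show "fits W (Op Less (Var 9) (vertex_count \<otimes> vertex_count)) t \<and>
      eval (Op Less (Var 9) (vertex_count \<otimes> vertex_count)) t = 0"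
    if "build_inv l (9 * n * (9 * n)) t" for t
    using f[OF that] b by simp
qed (rule s)

lemma build_inv_queries:
  assumes "build_inv l (9 * n * (9 * n)) s" "kk (9 * n) = k"
  shows "snd s 4 = apmc_input kk (9 * n) (query_graph n E (second_group n k l) (third_group n k l) True)"
    and "snd s 5 = apmc_input kk (9 * n) (query_graph n E (second_group n k l) (third_group n k l) False)"
proof -
  have eq: "h = apmc_input kk (9 * n) Q"
    if h: "h 0 = 9 * n" "h 1 = k" "\<forall>i < 9 * n * (9 * n). h (i + 2) = (if (i div (9 * n), i mod (9 * n)) \<in> Q then 1 else 0)"
      "\<forall>i \<ge> 9 * n * (9 * n). h (i + 2) = 0" for h Q
  proof
    fix i :: nat
    consider "i = 0" | "i = 1" | j where "i = j + 2"
      using that(1,2) that(3)[of "i - 2"] by linarith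
    then show "h i = apmc_input kk (9 * n) Q i"
    proof cases
      case 3
      with h show ?thesis by (cases "j < 9 * n * (9 * n)") (auto simp: apmc_input_def)
    qed (use h assms(2) in \<open>auto simp: apmc_input_def\<close>)
  qed
  show "snd s 4 = apmc_input kk (9 * n) (query_graph n E (second_group n k l) (third_group n k l) True)"
    "snd s 5 = apmc_input kk (9 * n) (query_graph n E (second_group n k l) (third_group n k l) False)"
    using assms(1) by (intro eq; simp add: build_inv_def outer_inv_def frame_def)+
qed

definition answers :: "nat \<Rightarrow> bool \<Rightarrow> (nat \<Rightarrow> nat) \<Rightarrow> bool" where
  "answers l full out \<longleftrightarrow> (\<forall>a<n. \<forall>d\<in>{3*n..<4*n}. out (a * (9 * n) + d) =
     min (min_vertex_cut (query_graph n E (second_group n k l) (third_group n k l) full) a d) k)"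

lemma answers_if_apmc_spec:
  assumes "kk (9 * n) = k"
    "apmc_spec kk (9 * n) (query_graph n E (second_group n k l) (third_group n k l) full) out"
  shows "answers l full out"
  using assms by (auto simp: answers_def apmc_spec_def min_def)

definition test_inv :: "nat \<Rightarrow> nat \<Rightarrow> state \<Rightarrow> bool" where
  "test_inv l m s \<longleftrightarrow> frame n k E s \<and> fst s 4 = l \<and> fst s 9 = m \<and>
     answers l True (snd s 6) \<and> answers l False (snd s 7) \<and>
     snd s 1 0 = (if (\<exists>l'<l. group_clique n k E l') \<or>
       (\<exists>i<m. clique_through n k E l (i div n) (3 * n + i mod n)) then 1 else 0)"

lemma runs_test_pair:
  assumes m: "m < n * n" and s: "test_inv l m s"
  shows "runs W (steps test_pair) test_pair (test_inv l (Suc m)) s"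
proof (rule runs_wp)
  define a d where "a = m div n" and "d = 3 * n + m mod n"
  define s' where "s' = (fst s)(10 := a, 11 := d)"
  have f: "fst s 0 = n" "fst s 9 = m" "snd s 0 = clique_input n E"
    using s by (auto simp: test_inv_def frame_def)
  have ad: "a < n" "d \<in> {3*n..<4*n}"
    using m n by (auto simp: a_def d_def less_mult_imp_div_less)
  have s'_regs: "s' 9 = m" "s' 0 = n" "s' 10 = a" "s' 11 = d"
    by (simp_all add: s'_def f)
  have adj: "eval adjacency (s', snd s) = (if (a, d) \<in> E then 1 else 0)" "fits W adjacency (s', snd s)"
    using adjacency_value[of "(s', snd s)" a d] ad by (simp_all add: s'_regs f)
  have "a * (9 * n) \<le> n * (9 * n)" using ad by (intro mult_le_mono1) simp
  then have b: "a * (9 * n) + d < W" "a * (9 * n) < W" "9 * n < W" "9 < W" "3 < W" "3 * n < W" "1 < W" "n < W"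
    "k < W" "m < W" "Suc m < W" "a < W" "d < W" "m mod n < W"
    using m ad k W mod_less_eq_dividend[of m n] unfolding atLeastLessThan_iff by linarith+
  have index: "eval answer_index (s', snd s) = a * (9 * n) + d" "fits W answer_index (s', snd s)"
    using b by (simp_all add: answer_index_def s'_regs)
  have cuts: "snd s 6 (a * (9 * n) + d) = min (min_vertex_cut (query_graph n E (second_group n k l) (third_group n k l) True) a d) k"
    "snd s 7 (a * (9 * n) + d) = min (min_vertex_cut (query_graph n E (second_group n k l) (third_group n k l) False) a d) k"
    using s ad by (auto simp: test_inv_def answers_def)
  \<comment> \<open>Reading an answer requires it to be a machine word, which the cap at
    \<open>k\<close> ensures.\<close>
  have fits: "snd s 6 (a * (9 * n) + d) < W" "snd s 7 (a * (9 * n) + d) < W"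
    unfolding cuts using b by (simp_all add: min.strict_coboundedI2)
  have test: "clique_through n k E l a d \<longleftrightarrow> (a, d) \<in> E \<and> snd s 7 (a * (9 * n) + d) < snd s 6 (a * (9 * n) + d)"
    unfolding cuts clique_through_def
    using cut_comparison[OF groups_subset(1)[of n k l] groups_subset(2)[of n k l] _ ad(2) card_groups_less, of a E]
      ad(1) k by simp
  let ?c = "clique_through n k E l a d"
  have ex: "(\<exists>i<Suc m. clique_through n k E l (i div n) (3 * n + i mod n)) \<longleftrightarrow>
      (\<exists>i<m. clique_through n k E l (i div n) (3 * n + i mod n)) \<or> ?c"
    by (auto simp: less_Suc_eq a_def d_def)
  have inv: "test_inv l (Suc m) (s'(9 := Suc m), if ?c then (snd s)(1 := (snd s 1)(0 := 1)) else snd s)"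
    using s by (simp add: test_inv_def frame_def s'_def ex)
  have "wp W (Cond (Op Eq (Const 1) adjacency)
       (Cond (Op Less (Read 7 answer_index) (Read 6 answer_index)) (Write 1 (Const 0) (Const 1)) Skip)
       Skip) Q (s', snd s) \<longleftrightarrow> Q (s', if ?c then (snd s)(1 := (snd s 1)(0 := 1)) else snd s)" for Q
    using adj index fits b unfolding test by simp
  with inv show "wp W test_pair (test_inv l (Suc m)) s"
    using b s'_regs unfolding test_pair_def
    by (simp add: f s'_def[symmetric] a_def[symmetric] d_def[symmetric])
qed

lemma runs_test:
  assumes "test_inv l 0 s"
  shows "runs W (n * n * Suc (steps test_pair) + 1)
    (While (Op Less (Var 9) (Var 0 \<otimes> Var 0)) test_pair) (test_inv l (n * n)) s"
proof (rule runs_While)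
  have b: "n * n < W" "n < W" "1 < W" using W by linarith+
  have f: "fst t 0 = n" "fst t 9 = m" if "test_inv l m t" for m t
    using that by (auto simp: test_inv_def frame_def)
  show "fits W (Op Less (Var 9) (Var 0 \<otimes> Var 0)) t \<and> eval (Op Less (Var 9) (Var 0 \<otimes> Var 0)) t \<noteq> 0 \<and>
      runs W (steps test_pair) test_pair (test_inv l (Suc m)) t"
    if "m < n * n" "test_inv l m t" for m t
    using runs_test_pair[OF that] f[OF that(2)] b that(1) by simp
  show "fits W (Op Less (Var 9) (Var 0 \<otimes> Var 0)) t \<and> eval (Op Less (Var 9) (Var 0 \<otimes> Var 0)) t = 0"
    if "test_inv l (n * n) t" for t
    using f[OF that] b by simp
qed (rule assms)

lemma test_inv_complete:
  assumes "test_inv l (n * n) s"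
  shows "outer_inv (Suc l) ((fst s)(4 := Suc l), snd s)"
proof -
  have "(\<exists>i<n * n. clique_through n k E l (i div n) (3 * n + i mod n)) \<longleftrightarrow> group_clique n k E l"
  proof
    assume "group_clique n k E l"
    then obtain a d where *: "a < n" "d \<in> {3*n..<4*n}" "clique_through n k E l a d"
      by (auto simp: group_clique_def)
    have "Suc a * n \<le> n * n" using * by (intro mult_le_mono1) simp
    moreover from * obtain j where j: "d = 3 * n + j" "j < n"
      using that[of "d - 3 * n"] by auto
    ultimately have "a * n + j < n * n" "(a * n + j) div n = a" "3 * n + (a * n + j) mod n = d" by auto
    with * show "\<exists>i<n * n. clique_through n k E l (i div n) (3 * n + i mod n)" by metis
  next
    assume "\<exists>i<n * n. clique_through n k E l (i div n) (3 * n + i mod n)"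
    then obtain i where "i < n * n" "clique_through n k E l (i div n) (3 * n + i mod n)" by blast
    with n show "group_clique n k E l"
      unfolding group_clique_def by (intro bexI[of _ "i div n"] bexI[of _ "3 * n + i mod n"])
        (auto simp: less_mult_imp_div_less)
  qed
  moreover have "(\<exists>l'<Suc l. group_clique n k E l') \<longleftrightarrow>
      (\<exists>l'<l. group_clique n k E l') \<or> group_clique n k E l"
    by (auto simp: less_Suc_eq)
  ultimately show ?thesis
    using assms by (simp add: test_inv_def outer_inv_def frame_def)
qed

context
  fixes P :: com and kk :: "nat \<Rightarrow> nat" and T :: real
  assumes kk: "kk (9 * n) = k"
    and P: "\<And>E'. dag (9 * n) E' \<Longrightarrow>
      computes_within W P (apmc_input kk (9 * n) E') T (apmc_spec kk (9 * n) E')"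
begin

lemma runs_process_groups:
  assumes l: "l < group_count n k * group_count n k" and s: "outer_inv l s"
  shows "runs W (steps select_groups + (9 * n * (9 * n) * Suc (steps build_entry) + 1) +
      2 * Suc (nat \<lfloor>T\<rfloor>) + (n * n * Suc (steps test_pair) + 3)) (process_groups P) (outer_inv (Suc l)) s"
proof -
  have dag: "dag (9 * n) (query_graph n E (second_group n k l) (third_group n k l) full)" for full
    by (rule dag_query_graph[OF groups_subset, of 0 _ "3 * n"]) (use n in auto)
  let ?inv = "build_inv l (9 * n * (9 * n))"
  have increment: "runs W 1 (Assign 4 (Var 4 \<oplus> Const 1)) (outer_inv (Suc l)) s" if "test_inv l (n * n) s" for s
  proof -
    have "fst s 4 = l" using that by (simp add: test_inv_def)
    moreover have "l + 1 < W" "1 < W" using l group_count_square W by linarith+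
    ultimately have "wp W (Assign 4 (Var 4 \<oplus> Const 1)) (outer_inv (Suc l)) s"
      using test_inv_complete[OF that] by simp
    from runs_wp[OF this] show ?thesis by simp
  qed
  have reset: "runs W 1 (Assign 9 (Const 0)) (test_inv l 0) s"
    if "?inv s \<and> answers l True (snd s 6) \<and> answers l False (snd s 7)" for s
  proof -
    have "wp W (Assign 9 (Const 0)) (test_inv l 0) s"
      using that W by (simp add: build_inv_def outer_inv_def test_inv_def frame_def)
    from runs_wp[OF this] show ?thesis by simp
  qed
  have call6: "runs W (Suc (nat \<lfloor>T\<rfloor>)) (Call P 4 6) (\<lambda>s. ?inv s \<and> answers l True (snd s 6)) s"
    if "?inv s" for s
  proof (rule runs_Call)
    show "computes_within W P (snd s 4) T (apmc_spec kk (9 * n)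
        (query_graph n E (second_group n k l) (third_group n k l) True))"
      unfolding build_inv_queries(1)[where kk = kk, OF that kk] by (rule P[OF dag])
  next
    fix out assume "apmc_spec kk (9 * n) (query_graph n E (second_group n k l) (third_group n k l) True) out"
    from answers_if_apmc_spec[where kk = kk, OF kk this] that
    show "?inv (fst s, (snd s)(6 := out)) \<and> answers l True (snd (fst s, (snd s)(6 := out)) 6)"
      by (simp add: build_inv_def outer_inv_def frame_def)
  qed
  have call7: "runs W (Suc (nat \<lfloor>T\<rfloor>)) (Call P 5 7)
      (\<lambda>s. ?inv s \<and> answers l True (snd s 6) \<and> answers l False (snd s 7)) s"
    if "?inv s \<and> answers l True (snd s 6)" for s
  proof (rule runs_Call)
    show "computes_within W P (snd s 5) T (apmc_spec kk (9 * n)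
        (query_graph n E (second_group n k l) (third_group n k l) False))"
      unfolding build_inv_queries(2)[where kk = kk, OF conjunct1[OF that] kk] by (rule P[OF dag])
  next
    fix out assume "apmc_spec kk (9 * n) (query_graph n E (second_group n k l) (third_group n k l) False) out"
    from answers_if_apmc_spec[where kk = kk, OF kk this] that
    show "?inv (fst s, (snd s)(7 := out)) \<and> answers l True (snd (fst s, (snd s)(7 := out)) 6) \<and>
        answers l False (snd (fst s, (snd s)(7 := out)) 7)"
      by (simp add: build_inv_def outer_inv_def frame_def)
  qed
  have "runs W (steps select_groups + ((9 * n * (9 * n) * Suc (steps build_entry) + 1) +
      (Suc (nat \<lfloor>T\<rfloor>) + (Suc (nat \<lfloor>T\<rfloor>) + (1 + (n * n * Suc (steps test_pair) + 1 + 1))))))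
      (process_groups P) (outer_inv (Suc l)) s"
    unfolding process_groups_def
    by (rule runs_Seq runs_select_groups[OF l s] runs_build[OF l] call6 call7 reset runs_test increment | assumption)+
  then show ?thesis by (rule runs_mono) simp_all
qed

lemma runs_clique_program:
  assumes "computes_within W P\<^sub>k (\<lambda>i. if i = 0 then 9 * n else 0) T\<^sub>k (\<lambda>out. out 0 = k)"
  shows "runs W (nat \<lfloor>T\<^sub>k\<rfloor> + 10 + (group_count n k * group_count n k *
      Suc (steps select_groups + (9 * n * (9 * n) * Suc (steps build_entry) + 1) +
        2 * Suc (nat \<lfloor>T\<rfloor>) + (n * n * Suc (steps test_pair) + 3)) + 1))
    (clique_program P\<^sub>k P) (\<lambda>s. clique_spec n E (snd s 1)) (start (clique_input n E))"
  unfolding clique_program_def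
proof (rule runs_Seq[OF runs_prepare[OF assms]])
  let ?G = "group_count n k"
  let ?e = "Op Less (Var 4) (Var 3 \<otimes> Var 3)"
  fix s assume s: "outer_inv 0 s"
  have f: "fst t 3 = ?G" "fst t 4 = l" if "outer_inv l t" for l t
    using that by (auto simp: outer_inv_def frame_def)
  have b: "?G * ?G < W" "?G < W" "1 < W" using group_count_square group_count_bounds(2) W by linarith+
  have "runs W (?G * ?G * Suc (steps select_groups + (9 * n * (9 * n) * Suc (steps build_entry) + 1) +
      2 * Suc (nat \<lfloor>T\<rfloor>) + (n * n * Suc (steps test_pair) + 3)) + 1)
    (While ?e (process_groups P)) (outer_inv (?G * ?G)) s"
  proof (rule runs_While)
    fix l t assume l: "l < ?G * ?G" and t: "outer_inv l t"
    show "fits W ?e t \<and> eval ?e t \<noteq> 0 \<and> runs W (steps select_groups + (9 * n * (9 * n) * Suc (steps build_entry) + 1) +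
      2 * Suc (nat \<lfloor>T\<rfloor>) + (n * n * Suc (steps test_pair) + 3)) (process_groups P) (outer_inv (Suc l)) t"
      using runs_process_groups[OF l t] f[OF t] b l by simp
  next
    fix t assume t: "outer_inv (?G * ?G) t"
    show "fits W ?e t \<and> eval ?e t = 0" using f[OF t] b by simp
  qed (rule s)
  then show "runs W (?G * ?G * Suc (steps select_groups + (9 * n * (9 * n) * Suc (steps build_entry) + 1) +
      2 * Suc (nat \<lfloor>T\<rfloor>) + (n * n * Suc (steps test_pair) + 3)) + 1)
    (While ?e (process_groups P)) (\<lambda>s. clique_spec n E (snd s 1)) s"
    by (rule runs_mono)
      (auto simp: clique_spec_def outer_inv_def four_clique_iff_group_clique[OF k(1)])
qed

end

end

section \<open>Running time\<close>

lemma card_ordered_pairs: "2 * card {(s, t). s < t \<and> t < (n::nat)} = n * (n - 1)"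
proof -
  have "{(s, t). s < t \<and> t < n} = (\<lambda>(t, s). (s, t)) ` (SIGMA t:{..<n}. {..<t})"
    by force
  then have "card {(s, t). s < t \<and> t < n} = card (SIGMA t:{..<n}. {..<t})"
    by (simp add: card_image inj_on_def)
  also have "\<dots> = (\<Sum>t<n. t)" by simp
  also have "2 * \<dots> = n * (n - 1)"
    by (induction n) (auto simp: algebra_simps)
  finally show ?thesis .
qed

text \<open>Writing down the answers takes quadratic time, so the query graphs may be written down for
  every call of the subroutine.\<close>

lemma apmc_time_lower_bound:
  assumes "computes_within W P (apmc_input k n (transitive_tournament n)) T
      (apmc_spec k n (transitive_tournament n))"
    and "2 \<le> n" "0 < k n"
  shows "real n ^ 2 \<le> 4 * T"
proof -
  let ?E = "transitive_tournament n"
  obtain m s where m: "exec W P (start (apmc_input k n ?E)) m s" "real m \<le> T" "apmc_spec k n ?E (snd s 1)"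
    using assms(1) unfolding computes_within_def by blast
  let ?pairs = "{(s, t). s < t \<and> t < n}"
  have "support (snd (start (apmc_input k n ?E)) 1) = {}"
    by (simp add: support_def start_def)
  with exec_support[OF m(1), of 1] have supp: "finite (support (snd s 1))" "card (support (snd s 1)) \<le> m"
    by auto
  have "inj_on (\<lambda>(u, v). u * n + v) ?pairs"
  proof (rule inj_onI, clarify)
    fix u v u' v' assume *: "v < n" "v' < n" "u * n + v = u' * n + v'"
    then have "(u * n + v) div n = (u' * n + v') div n" "(u * n + v) mod n = (u' * n + v') mod n" by auto
    with *(1,2) show "u = u' \<and> v = v'" by auto
  qed
  \<comment> \<open>The cut values for these pairs and the cap \<open>k n\<close> are positive, so
    all these answer cells are nonzero.\<close>
  moreover have "(\<lambda>(u, v). u * n + v) ` ?pairs \<subseteq> support (snd s 1)"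
    using m(3) cut_transitive_tournament assms(3) by (fastforce simp: apmc_spec_def support_def)
  ultimately have "card ?pairs \<le> card (support (snd s 1))"
    using supp(1) by (rule card_inj_on_le)
  with supp(2) have "n * (n - 1) \<le> 2 * m"
    using card_ordered_pairs[of n] by linarith
  moreover have "n * n \<le> 2 * (n * (n - 1))"
    using assms(2) by (auto simp: nat_le_iff_add)
  ultimately have "n * n \<le> 4 * m" by linarith
  then have "real (n * n) \<le> real (4 * m)" by (rule of_nat_mono)
  with m(2) show ?thesis by (simp add: power2_eq_square)
qed

text \<open>From \<open>k \<ge> 3\<close> follows \<open>k \<le> 4 * group_size k\<close>. The
  quotient in \<open>group_count\<close> thus contributes at most \<open>4 * n\<close>, and the
  extra group \<open>k \<le> 9 * n\<close>.\<close>

lemma group_count_times: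
  assumes "3 \<le> k" "k \<le> 9 * n"
  shows "group_count n k * k \<le> 13 * n"
proof -
  have "k \<le> 4 * group_size k" using assms(1) unfolding group_size_def by presburger
  then have "n div group_size k * k \<le> n div group_size k * (4 * group_size k)" by (rule mult_le_mono2)
  also have "\<dots> = 4 * (n div group_size k * group_size k)" by simp
  also have "\<dots> \<le> 4 * n" by (intro mult_le_mono2) simp
  finally show ?thesis using assms by (simp add: group_count_def)
qed

text \<open>Up to constants, \<open>N\<^sup>2 / k\<^sup>2\<close> is the number of calls. The powers
  of \<open>k\<close> combine to \<open>(k\<^sup>2) powr (- \<epsilon>)\<close>, at most
  \<open>N powr (- \<epsilon>)\<close> because \<open>k\<^sup>2 \<ge> N\<close>.\<close>

lemma query_cost_bound:
  fixes N k w \<epsilon> :: real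
  assumes "0 < N" "0 < k" "sqrt N \<le> k" "0 \<le> \<epsilon>"
  shows "N\<^sup>2 / k\<^sup>2 * (N powr (w - 1) * k\<^sup>2) powr (1 - \<epsilon>) \<le> N powr (w + 1 - \<epsilon> * w)"
proof -
  have k2: "N \<le> k\<^sup>2" using assms by (metis sqrt_le_D)
  have "N\<^sup>2 / k\<^sup>2 * (N powr (w - 1) * k\<^sup>2) powr (1 - \<epsilon>)
      = N powr 2 * (N powr ((w - 1) * (1 - \<epsilon>)) * ((k\<^sup>2) powr (1 - \<epsilon>) * (k\<^sup>2) powr (- 1)))"
    using assms by (simp add: powr_mult powr_powr powr_minus field_simps)
  also have "\<dots> = N powr (2 + (w - 1) * (1 - \<epsilon>)) * (k\<^sup>2) powr (- \<epsilon>)"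
    using powr_add[of "k\<^sup>2" "1 - \<epsilon>" "- 1"] by (simp add: powr_add)
  also have "\<dots> \<le> N powr (2 + (w - 1) * (1 - \<epsilon>)) * N powr (- \<epsilon>)"
    using assms k2 by (intro mult_left_mono powr_mono2') auto
  also have "\<dots> = N powr (w + 1 - \<epsilon> * w)"
    by (simp add: powr_add[symmetric] algebra_simps)
  finally show ?thesis .
qed

text \<open>The factors \<open>3\<close> come from \<open>9 * n + 2 \<le> (n + 2) ^ 3\<close>. The
  summand \<open>7\<close> pays for the polynomial that bounds the numbers handled by the reduction
  itself: two for its degree and five for its coefficients.\<close>

lemma word_bound:
  assumes "1 \<le> (n::nat)"
  shows "(9 * n + 2) ^ c \<le> (n + 2) ^ (3 * c + 3 * c' + 7)" "(9 * n + 2) ^ c' \<le> (n + 2) ^ (3 * c + 3 * c' + 7)"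
    "200 * (n * n) + 400 * n + 200 \<le> (n + 2) ^ (3 * c + 3 * c' + 7)"
proof -
  have mono: "(n + 2) ^ i \<le> (n + 2) ^ j" if "i \<le> j" for i j
    using that by (intro power_increasing) auto
  have "9 * n + 2 \<le> (n + 2) ^ 3"
    by (simp add: power3_eq_cube algebra_simps)
  then have "(9 * n + 2) ^ i \<le> (n + 2) ^ (3 * i)" for i
    unfolding power_mult by (intro power_mono) auto
  then show "(9 * n + 2) ^ c \<le> (n + 2) ^ (3 * c + 3 * c' + 7)" "(9 * n + 2) ^ c' \<le> (n + 2) ^ (3 * c + 3 * c' + 7)"
    using mono by (meson le_add1 le_add2 order_trans trans_le_add1)+
  have "200 * (n * n) + 400 * n + 200 \<le> 3 ^ 5 * (n + 2) ^ 2"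
    by (simp add: power2_eq_square algebra_simps)
  also have "\<dots> \<le> (n + 2) ^ 5 * (n + 2) ^ 2"
    using assms by (intro mult_le_mono1 power_mono) auto
  also have "\<dots> = (n + 2) ^ 7" by (simp flip: power_add)
  also have "\<dots> \<le> (n + 2) ^ (3 * c + 3 * c' + 7)" by (rule mono) simp
  finally show "200 * (n * n) + 400 * n + 200 \<le> (n + 2) ^ (3 * c + 3 * c' + 7)" .
qed

text \<open>By the quadratic lower bound on \<open>T\<close>, the cost of building and scanning the
  arrays and of computing the parameter is absorbed into a multiple of \<open>T\<close>;
  \<open>G \<ge> 1\<close> takes care of what is done only once.\<close>

lemma program_steps_bound:
  fixes n G :: nat and a b c T T\<^sub>k C\<^sub>k :: real
  assumes n: "1 \<le> n" and G: "1 \<le> G" and T: "(9 * real n)\<^sup>2 \<le> 4 * T" and T\<^sub>k: "T\<^sub>k \<le> C\<^sub>k * (9 * real n)\<^sup>2" and "0 \<le> C\<^sub>k"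
  shows "real (nat \<lfloor>T\<^sub>k\<rfloor> + 10 + (G * G *
      Suc (a' + (9 * n * (9 * n) * Suc b' + 1) + 2 * Suc (nat \<lfloor>T\<rfloor>) + (n * n * Suc c' + 3)) + 1))
    \<le> (4 * C\<^sub>k + 4 * a' + 4 * b' + 4 * c' + 100) * (real G ^ 2 * T)"
proof -
  have N: "1 \<le> (9 * real n)\<^sup>2" "real n ^ 2 \<le> (9 * real n)\<^sup>2"
    using n by (simp_all add: power_mult_distrib) (smt (verit) one_le_power of_nat_1 of_nat_mono One_nat_def)
  have G2: "1 \<le> real G ^ 2" using G by simp
  have T0: "0 \<le> T" "1 \<le> 4 * T" using N T by linarith+
  have "T\<^sub>k \<le> C\<^sub>k * (4 * T)" using T\<^sub>k mult_left_mono[OF T assms(5)] by linarith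
  then have "real (nat \<lfloor>T\<^sub>k\<rfloor>) \<le> C\<^sub>k * (4 * T)" using mult_nonneg_nonneg[of "C\<^sub>k" "4 * T"] T0 assms(5) by linarith
  moreover have "C\<^sub>k * (4 * T) + 11 \<le> (4 * C\<^sub>k + 44) * T" using T0 by (simp add: algebra_simps)
  ultimately have "real (nat \<lfloor>T\<^sub>k\<rfloor>) + 11 \<le> (4 * C\<^sub>k + 44) * T * 1" by linarith
  also have "\<dots> \<le> (4 * C\<^sub>k + 44) * T * real G ^ 2"
    using T0 assms(5) G2 by (intro mult_left_mono) auto
  finally have 1: "real (nat \<lfloor>T\<^sub>k\<rfloor>) + 11 \<le> (4 * C\<^sub>k + 44) * T * real G ^ 2" .
  have "real (Suc (a' + (9 * n * (9 * n) * Suc b' + 1) + 2 * Suc (nat \<lfloor>T\<rfloor>) + (n * n * Suc c' + 3)))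
      = (real a' + 7) * 1 + (9 * real n)\<^sup>2 * (b' + 1) + 2 * real (nat \<lfloor>T\<rfloor>) + real n ^ 2 * (c' + 1)"
    by (simp add: algebra_simps power2_eq_square)
  also have "\<dots> \<le> (real a' + 7) * (4 * T) + 4 * T * (b' + 1) + 2 * T + 4 * T * (c' + 1)"
    using N T T0 by (intro add_mono mult_left_mono mult_right_mono) auto
  also have "\<dots> \<le> (4 * a' + 4 * b' + 4 * c' + 56) * T"
    using T0 by (simp add: algebra_simps)
  finally have "real (G * G) * real (Suc (a' + (9 * n * (9 * n) * Suc b' + 1) + 2 * Suc (nat \<lfloor>T\<rfloor>) + (n * n * Suc c' + 3)))
      \<le> real (G * G) * ((4 * a' + 4 * b' + 4 * c' + 56) * T)"
    by (rule mult_left_mono) simp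
  with 1 show ?thesis by (simp add: algebra_simps power2_eq_square)
qed

section \<open>Both claims from one reduction\<close>

text \<open>Stated for a free \<open>w\<close>: \<open>mm_exponent\<close> gives the first claim,
  and \<open>w = 3\<close> turns the bounds into \<open>n\<^sup>2 k\<^sup>2\<close> and
  \<open>n powr 4\<close> for the second.\<close>

lemma four_clique_reduction:
  fixes w \<epsilon> :: real
  assumes "0 < \<epsilon>" and adm: "admissible_parameter kk"
    and apmc: "solves_bounded_apmc kk P f"
    and f: "\<And>n. 1 \<le> n \<Longrightarrow> f n = (real n powr (w - 1) * real (kk n) ^ 2) powr (1 - \<epsilon>)"
  shows "\<exists>Q. data_reduction reduction_roles P Q \<and> solves_four_clique Q (\<lambda>n. real n powr (w + 1 - \<epsilon> * w))"
proof -
  obtain P\<^sub>k c\<^sub>k C\<^sub>k where P\<^sub>k: "\<And>n. 1 \<le> n \<Longrightarrow> computes_within ((n + 2) ^ c\<^sub>k) P\<^sub>k (\<lambda>i. if i = 0 then n else 0)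
      (C\<^sub>k * real n ^ 2) (\<lambda>out. out 0 = kk n)"
    using adm unfolding admissible_parameter_def solves_in_O_def by auto
  obtain c C where P: "\<And>n E. 1 \<le> n \<Longrightarrow> dag n E \<Longrightarrow>
      computes_within ((n + 2) ^ c) P (apmc_input kk n E) (C * f n) (apmc_spec kk n E)"
    using apmc unfolding solves_bounded_apmc_def solves_in_O_def by blast
  have kk: "sqrt (real n) \<le> real (kk n)" "kk n \<le> n" for n
    using adm unfolding admissible_parameter_def by auto
  let ?K = "4 * \<bar>C\<^sub>k\<bar> + 4 * steps select_groups + 4 * steps build_entry + 4 * steps test_pair + 100"
  have "computes_within ((n + 2) ^ (3 * c\<^sub>k + 3 * c + 7)) (clique_program P\<^sub>k P) (clique_input n E)
      (?K * 169 * \<bar>C\<bar> * 9 powr (w + 1 - \<epsilon> * w) * real n powr (w + 1 - \<epsilon> * w)) (clique_spec n E)"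
    if n: "1 \<le> n" for n E
  proof -
    define N k G where "N = 9 * n" and "k = kk N" and "G = group_count n k"
    define T where "T = \<bar>C\<bar> * f N"
    define W where "W = (n + 2) ^ (3 * c\<^sub>k + 3 * c + 7)"
    have N: "1 \<le> N" "2 \<le> N" using n by (simp_all add: N_def)
    \<comment> \<open>The reason for padding to \<open>9 * n\<close> vertices: the parameter is at
      least three even for \<open>n = 1\<close>, so no small instances need separate
      treatment.\<close>
    have "3 \<le> sqrt (real N)" using n by (intro real_le_rsqrt) (simp add: N_def)
    with kk[of N] have k: "3 \<le> k" "k \<le> 9 * n" unfolding k_def by (linarith, simp add: N_def)
    have f0: "0 \<le> f N" using f[OF N(1)] by simp
    have W: "200 * (n * n) + 400 * n + 200 \<le> W" "(N + 2) ^ c\<^sub>k \<le> W" "(N + 2) ^ c \<le> W"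
      using word_bound[OF n] unfolding W_def N_def by blast+
    have solve: "computes_within W P (apmc_input kk N E') (C * f N) (apmc_spec kk N E')" if "dag N E'" for E'
      using computes_within_mono[OF P[OF N(1) that] W(3)] .
    \<comment> \<open>The assumed solver must itself write quadratically many answers for the
      tournament, so its time bound is at least quadratic.\<close>
    have "real N ^ 2 \<le> 4 * (C * f N)"
      using apmc_time_lower_bound[OF solve[OF dag_transitive_tournament] N(2)] k k_def by simp
    moreover have "C * f N \<le> T" unfolding T_def using f0 by (intro mult_right_mono) auto
    ultimately have T: "real N ^ 2 \<le> 4 * T" by linarith
    have solve': "computes_within W P (apmc_input kk N E') T (apmc_spec kk N E')" if "dag N E'" for E'
      using solve[OF that] \<open>C * f N \<le> T\<close> unfolding computes_within_def by (meson order_trans)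
    have "C\<^sub>k * real N ^ 2 \<le> \<bar>C\<^sub>k\<bar> * (9 * real n)\<^sup>2"
      unfolding N_def by (intro mult_mono) auto
    note time = program_steps_bound[OF n _ _ this, of G T "steps select_groups" "steps build_entry" "steps test_pair"]
    have G: "1 \<le> G" "G * k \<le> 13 * n"
      using group_count_times[OF k] by (simp_all add: G_def group_count_def)
    have "real G * real k \<le> 13 * real N"
      using G(2) by (simp add: N_def flip: of_nat_mult)
    then have "real G \<le> 13 * real N / real k" using k by (simp add: field_simps)
    then have "real G ^ 2 \<le> (13 * real N / real k) ^ 2" by (intro power_mono) auto
    then have "real G ^ 2 * T \<le> (13 * real N / real k) ^ 2 * T"
      using T by (intro mult_right_mono) (smt (verit) zero_le_power2)+
    also have "\<dots> = 169 * \<bar>C\<bar> * (real N ^ 2 / real k ^ 2 * f N)"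
      by (simp add: T_def power_divide power_mult_distrib)
    also have "\<dots> \<le> 169 * \<bar>C\<bar> * (real N powr (w + 1 - \<epsilon> * w))"
      using query_cost_bound[of "real N" "real k" \<epsilon> w] kk(1)[of N] N k assms(1)
      by (intro mult_left_mono) (simp_all add: f k_def)
    also have "\<dots> = 169 * \<bar>C\<bar> * 9 powr (w + 1 - \<epsilon> * w) * real n powr (w + 1 - \<epsilon> * w)"
      by (simp add: N_def powr_mult)
    finally have "?K * (real G ^ 2 * T) \<le> ?K * (169 * \<bar>C\<bar> * 9 powr (w + 1 - \<epsilon> * w) * real n powr (w + 1 - \<epsilon> * w))"
      by (rule mult_left_mono) simp
    then have bound: "?K * (real G ^ 2 * T) \<le> ?K * 169 * \<bar>C\<bar> * 9 powr (w + 1 - \<epsilon> * w) * real n powr (w + 1 - \<epsilon> * w)"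
      by (simp only: mult.assoc)
    have "runs W (nat \<lfloor>C\<^sub>k * real N ^ 2\<rfloor> + 10 + (G * G *
      Suc (steps select_groups + (9 * n * (9 * n) * Suc (steps build_entry) + 1) +
        2 * Suc (nat \<lfloor>T\<rfloor>) + (n * n * Suc (steps test_pair) + 3)) + 1))
      (clique_program P\<^sub>k P) (\<lambda>s. clique_spec n E (snd s 1)) (start (clique_input n E))"
      unfolding G_def
    proof (rule runs_clique_program[OF n k W(1)])
      show "kk (9 * n) = k" by (simp add: k_def N_def)
      show "computes_within W P (apmc_input kk (9 * n) E') T (apmc_spec kk (9 * n) E')" if "dag (9 * n) E'" for E'
        using solve' that by (simp add: N_def)
      show "computes_within W P\<^sub>k (\<lambda>i. if i = 0 then 9 * n else 0) (C\<^sub>k * (real N)\<^sup>2) (\<lambda>out. out 0 = k)"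
        using computes_within_mono[OF P\<^sub>k[OF N(1)] W(2)] unfolding N_def k_def .
    qed
    then obtain m s where m: "exec W (clique_program P\<^sub>k P) (start (clique_input n E)) m s" "clique_spec n E (snd s 1)"
      "m \<le> nat \<lfloor>C\<^sub>k * real N ^ 2\<rfloor> + 10 + (G * G *
      Suc (steps select_groups + (9 * n * (9 * n) * Suc (steps build_entry) + 1) +
        2 * Suc (nat \<lfloor>T\<rfloor>) + (n * n * Suc (steps test_pair) + 3)) + 1)"
      unfolding runs_def by blast
    have "real m \<le> ?K * (real G ^ 2 * T)"
      using of_nat_mono[OF m(3), where 'a = real] time G(1) T by (simp only: N_def) (auto elim: order_trans)
    with bound m(1,2) show ?thesis
      unfolding computes_within_def W_def by (meson order_trans)
  qed
  then have "solves_four_clique (clique_program P\<^sub>k P) (\<lambda>n. real n powr (w + 1 - \<epsilon> * w))"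
    unfolding solves_four_clique_def solves_in_O_def by blast
  then show ?thesis using data_reduction_clique_program by blast
qed

theorem theorem1:
  shows
    "(\<forall>\<epsilon>::real. \<epsilon> > 0 \<longrightarrow> (\<exists>\<delta>::real. \<delta> > 0 \<and>
        (\<forall>k :: nat \<Rightarrow> nat. admissible_parameter k \<longrightarrow>
          (\<exists>P. solves_bounded_apmc k P
                 (\<lambda>n. (real n powr (mm_exponent - 1) * real (k n) ^ 2) powr (1 - \<epsilon>))) \<longrightarrow>
          (\<exists>Q. solves_four_clique Q (\<lambda>n. real n powr (mm_exponent + 1 - \<delta>)))))) \<and>
     (\<forall>\<epsilon>::real. \<epsilon> > 0 \<longrightarrow> (\<exists>\<delta>::real. \<delta> > 0 \<and>
        (\<forall>(combinatorial :: com \<Rightarrow> bool) (k :: nat \<Rightarrow> nat).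
          combinatorial_class combinatorial \<longrightarrow> admissible_parameter k \<longrightarrow>
          (\<exists>P. combinatorial P \<and> solves_bounded_apmc k P
                 (\<lambda>n. (real n ^ 2 * real (k n) ^ 2) powr (1 - \<epsilon>))) \<longrightarrow>
          (\<exists>Q. combinatorial Q \<and> solves_four_clique Q (\<lambda>n. real n powr (4 - \<delta>))))))"
proof (intro conjI allI impI)
  fix \<epsilon> :: real
  assume \<epsilon>: "\<epsilon> > 0"
  \<comment> \<open>The witness for \<open>\<delta>\<close>; it depends neither on the parameter nor
    on the program.\<close>
  have "\<epsilon> * mm_exponent > 0" using \<epsilon> mm_exponent_ge_1 by simp
  moreover have "\<exists>Q. solves_four_clique Q (\<lambda>n. real n powr (mm_exponent + 1 - \<epsilon> * mm_exponent))"
    if "admissible_parameter k" "\<exists>P. solves_bounded_apmc k P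
        (\<lambda>n. (real n powr (mm_exponent - 1) * real (k n) ^ 2) powr (1 - \<epsilon>))" for k
    using that four_clique_reduction[OF \<epsilon> that(1), where w = mm_exponent] by blast
  ultimately show "\<exists>\<delta>::real. \<delta> > 0 \<and> (\<forall>k :: nat \<Rightarrow> nat. admissible_parameter k \<longrightarrow>
      (\<exists>P. solves_bounded_apmc k P
         (\<lambda>n. (real n powr (mm_exponent - 1) * real (k n) ^ 2) powr (1 - \<epsilon>))) \<longrightarrow>
      (\<exists>Q. solves_four_clique Q (\<lambda>n. real n powr (mm_exponent + 1 - \<delta>))))"
    by blast
next
  fix \<epsilon> :: real
  assume \<epsilon>: "\<epsilon> > 0"
  have "\<exists>Q. comb Q \<and> solves_four_clique Q (\<lambda>n. real n powr (4 - \<epsilon> * 3))"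
    if comb: "combinatorial_class comb" and adm: "admissible_parameter k"
      and P: "comb P" "solves_bounded_apmc k P (\<lambda>n. (real n ^ 2 * real (k n) ^ 2) powr (1 - \<epsilon>))" for comb k P
  proof -
    obtain Q where "data_reduction reduction_roles P Q" "solves_four_clique Q (\<lambda>n. real n powr (3 + 1 - \<epsilon> * 3))"
      using four_clique_reduction[OF \<epsilon> adm P(2), of 3] by auto
    moreover have "reduction_roles 0 = Input" "reduction_roles 1 = Output"
      "\<forall>a\<ge>2. reduction_roles a \<noteq> Input \<and> reduction_roles a \<noteq> Output"
      by (simp_all add: reduction_roles_def)
    ultimately have "comb Q" "solves_four_clique Q (\<lambda>n. real n powr (4 - \<epsilon> * 3))"
      using comb P(1) unfolding combinatorial_class_def by (blast, simp)
    then show ?thesis by blast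
  qed
  moreover have "\<epsilon> * 3 > 0" using \<epsilon> by simp
  ultimately show "\<exists>\<delta>::real. \<delta> > 0 \<and>
        (\<forall>(combinatorial :: com \<Rightarrow> bool) (k :: nat \<Rightarrow> nat).
          combinatorial_class combinatorial \<longrightarrow> admissible_parameter k \<longrightarrow>
          (\<exists>P. combinatorial P \<and> solves_bounded_apmc k P
                 (\<lambda>n. (real n ^ 2 * real (k n) ^ 2) powr (1 - \<epsilon>))) \<longrightarrow>
          (\<exists>Q. combinatorial Q \<and> solves_four_clique Q (\<lambda>n. real n powr (4 - \<delta>))))"
    by blast
qed

end
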